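(* Let $(\psi(\tau_1,\tau_2))_{(\tau_1,\tau_2)\in\Theta\times\Theta}$ be a bi-admissible, $p$-integrable family. For $S\in\Theta$ set $$V(S)=\operatorname*{ess\,sup}_{(\tau_1,\tau_2)\in\Theta_S\times\Theta_S}\rho_{S,\tau_1\vee\tau_2}[\psi(\tau_1,\tau_2)],$$ and assume $V(S)\in L^p$ for each $S\in\Theta$. For $S\in\Theta$ define $$v_1(S)=\operatorname*{ess\,sup}_{\tau_1\in\Theta_S}\rho_{S,\tau_1}[\psi(\tau_1,S)],\qquad v_2(S)=\operatorname*{ess\,sup}_{\tau_2\in\Theta_S}\rho_{S,\tau_2}[\psi(S,\tau_2)],$$ $$\phi(S)=v_1(S)\vee v_2(S),\qquad u(S)=\operatorname*{ess\,sup}_{\tau\in\Theta_S}\rho_{S,\tau}[\phi(\tau)].$$ Let $S\in\Theta$ and suppose that a pair $(\tau_1^*,\tau_2^* )\in\Theta_S\times\Theta_S$ is optimal for $V(S)$, i.e. $V(S)=\rho_{S,\tau_1^*\vee\tau_2^*}[\psi(\tau_1^*,\tau_2^* )]$. Let $A=\{\tau_1^*\le\tau_2^*\}$. Then: i) $\tau_1^*\wedge\tau_2^*$ is optimal for $u(S)$, i.e. $u(S)=\rho_{S,\tau_1^*\wedge\tau_2^*}[\phi(\tau_1^*\wedge\tau_2^* )]$. Moreover, if $\rho$ is strictly monotone, then: ii) $\tau_2^*$ is optimal for the problem with value $v_2(\tau_1^* )$ a.s. on $A$, i.e. $\rho_{\tau_1^*,\tau_1^*\vee\tau_2^*}[\psi(\tau_1^*,\tau_2^*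 )]=v_2(\tau_1^* )$ a.s. on $A$; iii) $\tau_1^*$ is optimal for the problem with value $v_1(\tau_2^* )$ a.s. on $A^c$, i.e. $\rho_{\tau_2^*,\tau_1^*\vee\tau_2^*}[\psi(\tau_1^*,\tau_2^* )]=v_1(\tau_2^* )$ a.s. on $A^c$.
   Context: Let $T>0$ be fixed and let $(\Omega,\mathcal F,P)$ be a complete probability space with a right-continuous complete filtration $(\mathcal F_t)_{t\in[0,T]}$. Equalities and inequalities between random variables, and equalities between measurable sets, are understood $P$-a.s. Let $(\theta_k)_{k\in\mathbb N}$ be a sequence of stopping times with $\theta_0=0$, $\theta_k\le\theta_{k+1}$ a.s. for all $k$, and $\lim_k\theta_k=T$ a.s. $\Theta$ (Bermudan stopping strategies) is the set of stopping times of the form $\tau=\sum_{k\ge0}\theta_k\mathbf 1_{A_k}+T\mathbf 1_{\bar A}$, where $\{(A_k)_{k\ge 0},\bar A\}$ is a partition of $\Omega$ with $A_k\in\mathcal F_{\theta_k}$ and $\bar A\in\mathcal F_T$. For $S\in\Theta$, $\Theta_S=\{\nu\in\Theta:\nu\ge S\text{ a.s.}\}$. Fix $p\in[1,+\infty]$. A family $\xi=(\xi(\tau))_{\tau\in\Theta}$ of real random variables is admissible if $\xi(\tau)$ is $\mathcal F_\tau$-measurable and $\xi(\tau)=\xi(\tau')$ a.s. on $\{\tau=\tau'\}$ for all $\tau,\tau'\in\Theta$; it is $p$-integrable if each $\xi(\tau)\in L^p$. A family $(\psi(\tau_1,\tau_2))_{(\tau_1,\tau_2)\in\Theta\times\Theta}$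 is bi-admissible if $\psi(\tau_1,\tau_2)$ is $\mathcal F_{\tau_1\vee\tau_2}$-measurable and $\psi(\tau_1,\tau_2)=\psi(\tilde\tau_1,\tilde\tau_2)$ on $\{\tau_1=\tilde\tau_1\}\cap\{\tau_2=\tilde\tau_2\}$; it is $p$-integrable if each $\psi(\tau_1,\tau_2)\in L^p$. The operators $\rho_{S,\tau}$, $S,\tau\in\Theta$, satisfy: (i) $\rho_{S,\tau}:L^p(\mathcal F_\tau)\to L^p(\mathcal F_S)$. (ii) (admissibility) $\rho_{S,\tau}[\eta]=\rho_{S',\tau}[\eta]$ a.s. on $\{S=S'\}$. (iii) (knowledge preservation) $\rho_{\tau,S}[\eta]=\eta$ for all $\eta\in L^p(\mathcal F_S)$, $\tau\in\Theta_S$. (iv) (monotonicity) $\rho_{S,\tau}[\eta_1]\le\rho_{S,\tau}[\eta_2]$ if $\eta_1\le\eta_2$ a.s. (v) (consistency) $\rho_{S,\theta}[\rho_{\theta,\tau}[\eta]]=\rho_{S,\tau}[\eta]$ for $S\le\theta\le\tau$ in $\Theta$, $\eta\in L^p(\mathcal F_\tau)$. (vi) (generalized zero-one law) $\mathbf 1_A\rho_{S,\tau}[\xi(\tau)]=\mathbf 1_A\rho_{S,\tau'}[\xi(\tau')]$ for every admissible $p$-integrable family $\xi$, $A\in\mathcal F_S$, $\tau,\tau'\in\Theta_S$ with $\tau=\tau'$ on $A$. (vi bis) For every bi-admissible $p$-integrable family $\psi$ and all Bermudan stopping times: $\mathbf 1_{\{\tau_1=\tau_1'\}}\rho_{\tau_1,\tau_1\vee\tau_2}[\psi(\tau_1,\tau_2)]=\mathbf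 1_{\{\tau_1=\tau_1'\}}\rho_{\tau_1',\tau_1'\vee\tau_2}[\psi(\tau_1',\tau_2)]$ and $\mathbf 1_{\{\tau_2=\tau_2'\}}\rho_{\tau_2,\tau_1\vee\tau_2}[\psi(\tau_1,\tau_2)]=\mathbf 1_{\{\tau_2=\tau_2'\}}\rho_{\tau_2',\tau_1\vee\tau_2'}[\psi(\tau_1,\tau_2')]$. (vi ter) For every bi-admissible $p$-integrable family $\psi$, all $\tau_1,\tau_2\in\Theta$ and $A\in\mathcal F_{\tau_1\wedge\tau_2}$ such that $\tau_1\wedge\tau_2=\tau_1$ and $\tau_1\vee\tau_2=\tau_2$ a.s. on $A$: $\mathbf 1_A\rho_{\tau_1\wedge\tau_2,\tau_1\vee\tau_2}[\psi(\tau_1\wedge\tau_2,\tau_1\vee\tau_2)]=\mathbf 1_A\rho_{\tau_1\wedge\tau_2,\tau_1\vee\tau_2}[\psi(\tau_1,\tau_2)]=\mathbf 1_A\rho_{\tau_1,\tau_1\vee\tau_2}[\psi(\tau_1,\tau_2)]$, and $\mathbf 1_A\rho_{\tau_1\wedge\tau_2,\tau_1\vee\tau_2}[\psi(\tau_1\vee\tau_2,\tau_1\wedge\tau_2)]=\mathbf 1_A\rho_{\tau_1\wedge\tau_2,\tau_1\vee\tau_2}[\psi(\tau_2,\tau_1)]=\mathbf 1_A\rho_{\tau_1,\tau_1\vee\tau_2}[\psi(\tau_2,\tau_1)]$. (vii) (monotone Fatou property) $\rho_{S,\tau}[\eta]\le\liminf_n\rho_{S,\tau}[\eta_n]$ whenever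 $(\eta_n)\subset L^p(\mathcal F_\tau)$ is non-decreasing, $\sup_n\eta_n\in L^p$ and $\eta_n\uparrow\eta$ a.s. $\rho$ is strictly monotone if, for all $S\le\tau$ in $\Theta$ and $\eta_1,\eta_2\in L^p(\mathcal F_\tau)$, $\eta_1\le\eta_2$ a.s. and $\rho_{S,\tau}[\eta_1]=\rho_{S,\tau}[\eta_2]$ a.s. imply $\eta_1=\eta_2$ a.s. *)

theory Defs
  imports "HOL-Probability.Probability" "HOL-Probability.Stopping_Time"
begin

text \<open>\<open>Lp M p G\<close> is \<open>L\<^sup>p(G)\<close> for a sub-sigma-algebra \<open>G\<close> of \<open>M\<close>; only the sets of \<open>G\<close>
  matter, integrals are with respect to \<open>M\<close>.  Elements are representatives, not classes.\<close>

definition Lp :: "'a measure \<Rightarrow> ennreal \<Rightarrow> 'a measure \<Rightarrow> ('a \<Rightarrow> real) set" where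
  "Lp M p G = {f \<in> borel_measurable G.
     if p = \<infinity> then \<exists>C. AE x in M. \<bar>f x\<bar> \<le> C
     else integrable M (\<lambda>x. \<bar>f x\<bar> powr enn2real p)}"

text \<open>The essential supremum of a (possibly uncountable) family of random variables, as opposed
  to the library's \<open>esssup\<close>, which is the essential supremum of one function.  It is extended
  real valued, exists on every probability space and is unique up to null sets.\<close>

definition is_ess_sup ::
  "'a measure \<Rightarrow> 'i set \<Rightarrow> ('i \<Rightarrow> 'a \<Rightarrow> real) \<Rightarrow> ('a \<Rightarrow> ereal) \<Rightarrow> bool" where
  "is_ess_sup M I f g \<longleftrightarrow>
     g \<in> borel_measurable M \<and>
     (\<forall>i\<in>I. AE x in M. ereal (f i x) \<le> g x) \<and>
     (\<forall>h\<in>borel_measurable M. (\<forall>i\<in>I. AE x in M. ereal (f i x) \<le> h x) \<longrightarrow> (AE x in M. g x \<le> h x))"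

definition ess_sup :: "'a measure \<Rightarrow> 'i set \<Rightarrow> ('i \<Rightarrow> 'a \<Rightarrow> real) \<Rightarrow> 'a \<Rightarrow> ereal" where
  "ess_sup M I f = (SOME g. is_ess_sup M I f g)"

text \<open>A filtration on \<open>[0,T]\<close> is represented by a filtration indexed by all reals.  For a time
  \<open>\<tau>\<close> with values in \<open>[0,T]\<close>, neither being a stopping time nor the sigma-algebra of \<open>\<tau>\<close>
  depends on the filtration outside \<open>[0,T]\<close>.\<close>

abbreviation sigma_at :: "'a measure \<Rightarrow> (real \<Rightarrow> 'a measure) \<Rightarrow> ('a \<Rightarrow> real) \<Rightarrow> 'a measure" where
  "sigma_at M F \<tau> \<equiv> filtration.pre_sigma (space M) F \<tau>"

definition stopping_times :: "'a measure \<Rightarrow> (real \<Rightarrow> 'a measure) \<Rightarrow> real \<Rightarrow> ('a \<Rightarrow> real) set" where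
  "stopping_times M F T = {\<tau>. stopping_time F \<tau> \<and> (\<forall>x\<in>space M. 0 \<le> \<tau> x \<and> \<tau> x \<le> T)}"

definition bermudan_times ::
  "'a measure \<Rightarrow> (real \<Rightarrow> 'a measure) \<Rightarrow> real \<Rightarrow> (nat \<Rightarrow> 'a \<Rightarrow> real) \<Rightarrow> ('a \<Rightarrow> real) set" where
  "bermudan_times M F T \<theta> = {\<tau> \<in> stopping_times M F T.
     \<exists>A B. disjoint_family A \<and> (\<Union>k. A k) \<inter> B = {} \<and> (\<Union>k. A k) \<union> B = space M \<and>
       (\<forall>k. A k \<in> sets (sigma_at M F (\<theta> k))) \<and> B \<in> sets (F T) \<and>
       (AE x in M. \<tau> x = (\<Sum>k. \<theta> k x * indicator (A k) x) + T * indicator B x)}"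

definition times_from :: "'a measure \<Rightarrow> ('a \<Rightarrow> real) set \<Rightarrow> ('a \<Rightarrow> real) \<Rightarrow> ('a \<Rightarrow> real) set" where
  "times_from M \<Theta> S = {\<nu> \<in> \<Theta>. AE x in M. S x \<le> \<nu> x}"

definition admissible ::
  "'a measure \<Rightarrow> (real \<Rightarrow> 'a measure) \<Rightarrow> ('a \<Rightarrow> real) set \<Rightarrow> (('a \<Rightarrow> real) \<Rightarrow> 'a \<Rightarrow> real) \<Rightarrow> bool" where
  "admissible M F \<Theta> \<xi> \<longleftrightarrow>
     (\<forall>\<tau>\<in>\<Theta>. \<xi> \<tau> \<in> borel_measurable (sigma_at M F \<tau>)) \<and>
     (\<forall>\<tau>\<in>\<Theta>. \<forall>\<tau>'\<in>\<Theta>. AE x in M. \<tau> x = \<tau>' x \<longrightarrow> \<xi> \<tau> x = \<xi> \<tau>' x)"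

definition p_integrable ::
  "'a measure \<Rightarrow> ennreal \<Rightarrow> ('a \<Rightarrow> real) set \<Rightarrow> (('a \<Rightarrow> real) \<Rightarrow> 'a \<Rightarrow> real) \<Rightarrow> bool" where
  "p_integrable M p \<Theta> \<xi> \<longleftrightarrow> (\<forall>\<tau>\<in>\<Theta>. \<xi> \<tau> \<in> Lp M p M)"

definition bi_admissible ::
  "'a measure \<Rightarrow> (real \<Rightarrow> 'a measure) \<Rightarrow> ('a \<Rightarrow> real) set \<Rightarrow>
    (('a \<Rightarrow> real) \<Rightarrow> ('a \<Rightarrow> real) \<Rightarrow> 'a \<Rightarrow> real) \<Rightarrow> bool" where
  "bi_admissible M F \<Theta> \<psi> \<longleftrightarrow>
     (\<forall>\<tau>1\<in>\<Theta>. \<forall>\<tau>2\<in>\<Theta>. \<psi> \<tau>1 \<tau>2 \<in> borel_measurable (sigma_at M F (sup \<tau>1 \<tau>2))) \<and>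
     (\<forall>\<tau>1\<in>\<Theta>. \<forall>\<tau>2\<in>\<Theta>. \<forall>\<tau>1'\<in>\<Theta>. \<forall>\<tau>2'\<in>\<Theta>.
        AE x in M. \<tau>1 x = \<tau>1' x \<and> \<tau>2 x = \<tau>2' x \<longrightarrow> \<psi> \<tau>1 \<tau>2 x = \<psi> \<tau>1' \<tau>2' x)"

definition bi_p_integrable ::
  "'a measure \<Rightarrow> ennreal \<Rightarrow> ('a \<Rightarrow> real) set \<Rightarrow>
    (('a \<Rightarrow> real) \<Rightarrow> ('a \<Rightarrow> real) \<Rightarrow> 'a \<Rightarrow> real) \<Rightarrow> bool" where
  "bi_p_integrable M p \<Theta> \<psi> \<longleftrightarrow> (\<forall>\<tau>1\<in>\<Theta>. \<forall>\<tau>2\<in>\<Theta>. \<psi> \<tau>1 \<tau>2 \<in> Lp M p M)"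

locale bermudan_setting =
  prob_space M + complete_measure M + filtration "space M" F
  for M :: "'a measure" and F :: "real \<Rightarrow> 'a measure" +
  fixes T :: real and \<theta> :: "nat \<Rightarrow> 'a \<Rightarrow> real"
  assumes T_pos: "T > 0"
    and F_sub: "\<And>t. t \<in> {0..T} \<Longrightarrow> sets (F t) \<subseteq> sets M"
    and F_complete: "null_sets M \<subseteq> sets (F 0)"
    and F_right_continuous: "\<And>t. t \<in> {0..<T} \<Longrightarrow> sets (F t) = (\<Inter>s\<in>{t<..T}. sets (F s))"
    and theta_stopping: "\<And>k. \<theta> k \<in> stopping_times M F T"
    and theta_0: "AE x in M. \<theta> 0 x = 0"
    and theta_mono: "\<And>k. AE x in M. \<theta> k x \<le> \<theta> (Suc k) x"
    and theta_lim: "AE x in M. (\<lambda>k. \<theta> k x) \<longlonglongrightarrow> T"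
begin

abbreviation Theta :: "('a \<Rightarrow> real) set" where
  "Theta \<equiv> bermudan_times M F T \<theta>"

abbreviation Theta_from :: "('a \<Rightarrow> real) \<Rightarrow> ('a \<Rightarrow> real) set" where
  "Theta_from S \<equiv> times_from M Theta S"

end

text \<open>Well-definedness of the operators on almost-sure classes is not a separate axiom: it
  follows from \<open>rho_mono\<close>.\<close>

locale nonlinear_evaluation = bermudan_setting M F T \<theta>
  for M :: "'a measure" and F T \<theta> +
  fixes p :: ennreal
    and \<rho> :: "('a \<Rightarrow> real) \<Rightarrow> ('a \<Rightarrow> real) \<Rightarrow> ('a \<Rightarrow> real) \<Rightarrow> 'a \<Rightarrow> real"
  assumes p_ge_1: "1 \<le> p"
    and rho_Lp: "\<And>S \<tau> \<eta>. S \<in> Theta \<Longrightarrow> \<tau> \<in> Theta \<Longrightarrow> \<eta> \<in> Lp M p (pre_sigma \<tau>) \<Longrightarrow>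
      \<rho> S \<tau> \<eta> \<in> Lp M p (pre_sigma S)"
    and rho_admissible: "\<And>S S' \<tau> \<eta>. S \<in> Theta \<Longrightarrow> S' \<in> Theta \<Longrightarrow> \<tau> \<in> Theta \<Longrightarrow>
      \<eta> \<in> Lp M p (pre_sigma \<tau>) \<Longrightarrow>
      AE x in M. S x = S' x \<longrightarrow> \<rho> S \<tau> \<eta> x = \<rho> S' \<tau> \<eta> x"
    and rho_knowledge: "\<And>S \<tau> \<eta>. S \<in> Theta \<Longrightarrow> \<tau> \<in> Theta_from S \<Longrightarrow>
      \<eta> \<in> Lp M p (pre_sigma S) \<Longrightarrow> AE x in M. \<rho> \<tau> S \<eta> x = \<eta> x"
    and rho_mono: "\<And>S \<tau> \<eta>1 \<eta>2. S \<in> Theta \<Longrightarrow> \<tau> \<in> Theta \<Longrightarrow>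
      \<eta>1 \<in> Lp M p (pre_sigma \<tau>) \<Longrightarrow> \<eta>2 \<in> Lp M p (pre_sigma \<tau>) \<Longrightarrow>
      AE x in M. \<eta>1 x \<le> \<eta>2 x \<Longrightarrow> AE x in M. \<rho> S \<tau> \<eta>1 x \<le> \<rho> S \<tau> \<eta>2 x"
    and rho_consistent: "\<And>S \<nu> \<tau> \<eta>. S \<in> Theta \<Longrightarrow> \<nu> \<in> Theta \<Longrightarrow> \<tau> \<in> Theta \<Longrightarrow>
      AE x in M. S x \<le> \<nu> x \<Longrightarrow> AE x in M. \<nu> x \<le> \<tau> x \<Longrightarrow> \<eta> \<in> Lp M p (pre_sigma \<tau>) \<Longrightarrow>
      AE x in M. \<rho> S \<nu> (\<rho> \<nu> \<tau> \<eta>) x = \<rho> S \<tau> \<eta> x"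
    and rho_zero_one: "\<And>\<xi> S \<tau> \<tau>' A.
      admissible M F Theta \<xi> \<Longrightarrow> p_integrable M p Theta \<xi> \<Longrightarrow>
      S \<in> Theta \<Longrightarrow> A \<in> sets (pre_sigma S) \<Longrightarrow> \<tau> \<in> Theta_from S \<Longrightarrow> \<tau>' \<in> Theta_from S \<Longrightarrow>
      AE x in M. x \<in> A \<longrightarrow> \<tau> x = \<tau>' x \<Longrightarrow>
      AE x in M. x \<in> A \<longrightarrow> \<rho> S \<tau> (\<xi> \<tau>) x = \<rho> S \<tau>' (\<xi> \<tau>') x"
    and rho_bis_1: "\<And>\<psi> \<tau>1 \<tau>1' \<tau>2.
      bi_admissible M F Theta \<psi> \<Longrightarrow> bi_p_integrable M p Theta \<psi> \<Longrightarrow>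
      \<tau>1 \<in> Theta \<Longrightarrow> \<tau>1' \<in> Theta \<Longrightarrow> \<tau>2 \<in> Theta \<Longrightarrow>
      AE x in M. \<tau>1 x = \<tau>1' x \<longrightarrow>
        \<rho> \<tau>1 (sup \<tau>1 \<tau>2) (\<psi> \<tau>1 \<tau>2) x = \<rho> \<tau>1' (sup \<tau>1' \<tau>2) (\<psi> \<tau>1' \<tau>2) x"
    and rho_bis_2: "\<And>\<psi> \<tau>1 \<tau>2 \<tau>2'.
      bi_admissible M F Theta \<psi> \<Longrightarrow> bi_p_integrable M p Theta \<psi> \<Longrightarrow>
      \<tau>1 \<in> Theta \<Longrightarrow> \<tau>2 \<in> Theta \<Longrightarrow> \<tau>2' \<in> Theta \<Longrightarrow>
      AE x in M. \<tau>2 x = \<tau>2' x \<longrightarrow>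
        \<rho> \<tau>2 (sup \<tau>1 \<tau>2) (\<psi> \<tau>1 \<tau>2) x = \<rho> \<tau>2' (sup \<tau>1 \<tau>2') (\<psi> \<tau>1 \<tau>2') x"
    and rho_ter_1: "\<And>\<psi> \<tau>1 \<tau>2 A.
      bi_admissible M F Theta \<psi> \<Longrightarrow> bi_p_integrable M p Theta \<psi> \<Longrightarrow>
      \<tau>1 \<in> Theta \<Longrightarrow> \<tau>2 \<in> Theta \<Longrightarrow> A \<in> sets (pre_sigma (inf \<tau>1 \<tau>2)) \<Longrightarrow>
      AE x in M. x \<in> A \<longrightarrow> inf \<tau>1 \<tau>2 x = \<tau>1 x \<and> sup \<tau>1 \<tau>2 x = \<tau>2 x \<Longrightarrow>
      AE x in M. x \<in> A \<longrightarrow>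
        \<rho> (inf \<tau>1 \<tau>2) (sup \<tau>1 \<tau>2) (\<psi> (inf \<tau>1 \<tau>2) (sup \<tau>1 \<tau>2)) x
          = \<rho> (inf \<tau>1 \<tau>2) (sup \<tau>1 \<tau>2) (\<psi> \<tau>1 \<tau>2) x \<and>
        \<rho> (inf \<tau>1 \<tau>2) (sup \<tau>1 \<tau>2) (\<psi> \<tau>1 \<tau>2) x = \<rho> \<tau>1 (sup \<tau>1 \<tau>2) (\<psi> \<tau>1 \<tau>2) x"
    and rho_ter_2: "\<And>\<psi> \<tau>1 \<tau>2 A.
      bi_admissible M F Theta \<psi> \<Longrightarrow> bi_p_integrable M p Theta \<psi> \<Longrightarrow>
      \<tau>1 \<in> Theta \<Longrightarrow> \<tau>2 \<in> Theta \<Longrightarrow> A \<in> sets (pre_sigma (inf \<tau>1 \<tau>2)) \<Longrightarrow>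
      AE x in M. x \<in> A \<longrightarrow> inf \<tau>1 \<tau>2 x = \<tau>1 x \<and> sup \<tau>1 \<tau>2 x = \<tau>2 x \<Longrightarrow>
      AE x in M. x \<in> A \<longrightarrow>
        \<rho> (inf \<tau>1 \<tau>2) (sup \<tau>1 \<tau>2) (\<psi> (sup \<tau>1 \<tau>2) (inf \<tau>1 \<tau>2)) x
          = \<rho> (inf \<tau>1 \<tau>2) (sup \<tau>1 \<tau>2) (\<psi> \<tau>2 \<tau>1) x \<and>
        \<rho> (inf \<tau>1 \<tau>2) (sup \<tau>1 \<tau>2) (\<psi> \<tau>2 \<tau>1) x = \<rho> \<tau>1 (sup \<tau>1 \<tau>2) (\<psi> \<tau>2 \<tau>1) x"
    and rho_Fatou: "\<And>S \<tau> \<eta> \<eta>s. S \<in> Theta \<Longrightarrow> \<tau> \<in> Theta \<Longrightarrow>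
      (\<And>n::nat. \<eta>s n \<in> Lp M p (pre_sigma \<tau>)) \<Longrightarrow> \<eta> \<in> Lp M p (pre_sigma \<tau>) \<Longrightarrow>
      (\<And>n. AE x in M. \<eta>s n x \<le> \<eta>s (Suc n) x) \<Longrightarrow>
      AE x in M. (\<lambda>n. \<eta>s n x) \<longlonglongrightarrow> \<eta> x \<Longrightarrow>
      AE x in M. ereal (\<rho> S \<tau> \<eta> x) \<le> liminf (\<lambda>n. ereal (\<rho> S \<tau> (\<eta>s n) x))"

definition strictly_monotone ::
  "'a measure \<Rightarrow> (real \<Rightarrow> 'a measure) \<Rightarrow> ('a \<Rightarrow> real) set \<Rightarrow> ennreal \<Rightarrow>
    (('a \<Rightarrow> real) \<Rightarrow> ('a \<Rightarrow> real) \<Rightarrow> ('a \<Rightarrow> real) \<Rightarrow> 'a \<Rightarrow> real) \<Rightarrow> bool" where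
  "strictly_monotone M F \<Theta> p \<rho> \<longleftrightarrow>
     (\<forall>S\<in>\<Theta>. \<forall>\<tau>\<in>times_from M \<Theta> S.
        \<forall>\<eta>1\<in>Lp M p (sigma_at M F \<tau>). \<forall>\<eta>2\<in>Lp M p (sigma_at M F \<tau>).
          (AE x in M. \<eta>1 x \<le> \<eta>2 x) \<longrightarrow> (AE x in M. \<rho> S \<tau> \<eta>1 x = \<rho> S \<tau> \<eta>2 x) \<longrightarrow>
          (AE x in M. \<eta>1 x = \<eta>2 x))"

end

theory Submission
  imports Defs
begin

text \<open>
  Write \<open>m = inf \<tau>1 \<tau>2\<close> for the first of the two stopping times and
  \<open>reward R a b = \<rho> R (sup a b) (\<psi> a b)\<close> for the evaluation at time \<open>R\<close> of the pair \<open>(a, b)\<close>.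
  The theorem compares two ways of spending the two stopping decisions after \<open>S\<close>.

  Stopping once at \<open>\<tau>\<close> to collect \<open>\<phi>(\<tau>)\<close> cannot beat an optimal pair.  Indeed \<open>\<phi>(\<tau>) \<le> V(\<tau>)\<close>, because the
  pairs with one component equal to \<open>\<tau>\<close> compete in \<open>V(\<tau>)\<close>, and \<open>V\<close> is a supermartingale for \<open>\<rho>\<close>
  (\<open>pair_value_supermartingale\<close>): the rewards evaluated at \<open>\<tau>\<close> are directed upwards, so \<open>V(\<tau>)\<close> is an
  increasing limit of rewards, and the Fatou property together with consistency bounds
  \<open>\<rho> S \<tau> (V(\<tau>))\<close> by \<open>V(S)\<close>.  Hence \<open>u(S) \<le> V(S)\<close>.

  Conversely, at time \<open>m\<close> one of the two decisions of the optimal pair has been spent, and only a single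
  stopping problem is left, so that \<open>reward m \<tau>1 \<tau>2 \<le> \<phi>(m)\<close> (\<open>reward_le_stop_value\<close>).  Consistency
  and optimality then give
  \<open>V(S) = \<rho> S m (reward m \<tau>1 \<tau>2) \<le> \<rho> S m (\<phi>(m)) \<le> u(S) \<le> V(S)\<close>.
  All terms are equal, which is the optimality of \<open>m\<close> for \<open>u(S)\<close>.  If \<open>\<rho>\<close> is strictly monotone,
  equality of the two middle terms forces \<open>reward m \<tau>1 \<tau>2 = \<phi>(m)\<close>; on \<open>{\<tau>1 \<le> \<tau>2}\<close>, where \<open>m = \<tau>1\<close>,
  the left side is at most \<open>v2(m)\<close>, so the second time is optimal there
  (\<open>second_value_attained\<close>).  The statement on the complement is the same one for the family with its
  two arguments exchanged.

  Directedness, the bound by \<open>\<phi>(m)\<close> and the last step all rest on the locality of the reward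
  (\<open>reward_local\<close>): two pairs that agree on an event known at time \<open>R\<close> have the same reward at \<open>R\<close> on
  that event.  The zero-one law speaks of families indexed by a single time, so it has to be
  transferred to pairs; \<open>rho_stop_off_event\<close> does this.
\<close>

section \<open>Essential suprema and domination in \<open>L\<^sup>p\<close>\<close>

text \<open>
  The bounded increasing transform \<open>arctan\<close> turns suprema over countable subfamilies into functions
  with finite integrals.  A countable union of subfamilies whose integrals approach the least upper
  bound attains it; enlarging that union by one more member cannot raise the integral any more, so it
  changes the supremum on a null set only.
\<close>

lemma (in finite_measure) countable_ess_sup:
  fixes f :: "'i \<Rightarrow> 'a \<Rightarrow> real"
  assumes meas: "\<And>i. i \<in> I \<Longrightarrow> f i \<in> borel_measurable M"
  obtains J where "countable J" "J \<subseteq> I" "is_ess_sup M I f (\<lambda>x. SUP i\<in>J. ereal (f i x))"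
proof -
  \<comment> \<open>The shift by \<open>2 > pi / 2\<close> makes the transform positive, as \<open>ennreal\<close> requires.\<close>
  define a where "a i x = ennreal (arctan (f i x) + 2)" for i x
  define \<Phi> where "\<Phi> J = (\<integral>\<^sup>+x. (SUP i\<in>J. a i x) \<partial>M)" for J
  define C where "C = {J. countable J \<and> J \<subseteq> I}"
  have a_le: "a i x \<le> 4" for i x
  proof -
    have "arctan (f i x) + 2 \<le> 4"
      using arctan_ubound[of "f i x"] pi_less_4 by linarith
    then have "a i x \<le> ennreal 4" unfolding a_def by (rule ennreal_leI)
    then show ?thesis by simp
  qed
  have a_meas: "(\<lambda>x. SUP i\<in>J. a i x) \<in> borel_measurable M" if "J \<in> C" for J
  proof (rule borel_measurable_SUP)
    show "countable J" using that by (auto simp: C_def)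
    show "a i \<in> borel_measurable M" if "i \<in> J" for i
    proof -
      have [measurable]: "f i \<in> borel_measurable M" using meas \<open>J \<in> C\<close> that by (auto simp: C_def)
      show ?thesis unfolding a_def by measurable
    qed
  qed
  have fin: "\<Phi> J < \<infinity>" for J
  proof -
    have "\<Phi> J \<le> (\<integral>\<^sup>+x. 4 \<partial>M)"
      unfolding \<Phi>_def by (intro nn_integral_mono SUP_least a_le)
    also have "\<dots> < \<infinity>" by (simp add: ennreal_mult_eq_top_iff less_top[symmetric])
    finally show ?thesis .
  qed
  have "C \<noteq> {}" by (auto simp: C_def)
  from ennreal_SUP_countable_SUP[OF this, of \<Phi>]
  obtain s :: "nat \<Rightarrow> ennreal" where s: "range s \<subseteq> \<Phi> ` C" "(SUP J\<in>C. \<Phi> J) = (SUP n. s n)"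
    by auto
  from s(1) have "\<forall>n. \<exists>J\<in>C. s n = \<Phi> J" by auto
  then obtain Js where Js: "\<And>n. Js n \<in> C" "\<And>n. s n = \<Phi> (Js n)" by metis
  define J where "J = (\<Union>n. Js n)"
  have JC: "J \<in> C" using Js(1) by (auto simp: J_def C_def)
  have mono: "\<Phi> K \<le> \<Phi> L" if "K \<subseteq> L" for K L
    unfolding \<Phi>_def by (intro nn_integral_mono SUP_subset_mono that order_refl)
  have max: "\<Phi> K \<le> \<Phi> J" if "K \<in> C" for K
  proof -
    have "\<Phi> K \<le> (SUP n. s n)" unfolding s(2)[symmetric] using that by (rule SUP_upper)
    also have "\<dots> \<le> \<Phi> J" unfolding Js(2) by (intro SUP_least mono) (auto simp: J_def)
    finally show ?thesis .
  qed
  have upper: "AE x in M. ereal (f i x) \<le> (SUP j\<in>J. ereal (f j x))" if i: "i \<in> I" for i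
  proof -
    have iJ: "insert i J \<in> C" using i JC by (auto simp: C_def)
    have "AE x in M. (SUP j\<in>insert i J. a j x) \<le> (SUP j\<in>J. a j x)"
    proof (rule ccontr)
      assume neg: "\<not> ?thesis"
      have "\<Phi> J < \<Phi> (insert i J)"
        unfolding \<Phi>_def
      proof (rule nn_integral_less[OF a_meas[OF JC] a_meas[OF iJ] _ _ neg])
        show "(\<integral>\<^sup>+ x. (SUP j\<in>J. a j x) \<partial>M) \<noteq> \<infinity>" using fin[of J] by (auto simp: \<Phi>_def)
        show "AE x in M. (SUP j\<in>J. a j x) \<le> (SUP j\<in>insert i J. a j x)"
          by (intro AE_I2 SUP_subset_mono) auto
      qed
      with max[OF iJ] show False by simp
    qed
    then show ?thesis
    proof eventually_elim
      case (elim x)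
      show ?case
      proof (rule ccontr)
        assume "\<not> ?case"
        then have "(SUP j\<in>J. ereal (f j x)) < ereal (f i x)" by simp
        then obtain c where c: "(SUP j\<in>J. ereal (f j x)) < ereal c" "ereal c < ereal (f i x)"
          using ereal_dense2 by blast
        have "(SUP j\<in>J. a j x) \<le> ennreal (arctan c + 2)"
        proof (rule SUP_least)
          fix j assume "j \<in> J"
          then have "ereal (f j x) \<le> (SUP j\<in>J. ereal (f j x))" by (rule SUP_upper)
          also have "\<dots> < ereal c" by (rule c(1))
          finally have "f j x \<le> c" by simp
          then show "a j x \<le> ennreal (arctan c + 2)" unfolding a_def by (intro ennreal_leI) (simp add: arctan_le_iff)
        qed
        also have "\<dots> < a i x"
          unfolding a_def
        proof (rule ennreal_lessI)
          have less: "arctan c < arctan (f i x)" using c(2) by (simp add: arctan_less_iff)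
          then show "arctan c + 2 < arctan (f i x) + 2" by simp
          show "0 < arctan (f i x) + 2" using less arctan_lbound[of c] pi_less_4 by linarith
        qed
        also have "\<dots> \<le> (SUP j\<in>insert i J. a j x)" by (intro SUP_upper) simp
        finally show False using elim by (meson leD)
      qed
    qed
  qed
  have "is_ess_sup M I f (\<lambda>x. SUP i\<in>J. ereal (f i x))"
    unfolding is_ess_sup_def
  proof (intro conjI ballI impI upper)
    show "(\<lambda>x. SUP i\<in>J. ereal (f i x)) \<in> borel_measurable M"
      using JC meas by (intro borel_measurable_SUP borel_measurable_ereal) (auto simp: C_def)
    fix h :: "'a \<Rightarrow> ereal" assume "\<forall>i\<in>I. AE x in M. ereal (f i x) \<le> h x"
    with JC have "AE x in M. \<forall>i\<in>J. ereal (f i x) \<le> h x"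
      by (subst AE_ball_countable) (auto simp: C_def)
    then show "AE x in M. (SUP i\<in>J. ereal (f i x)) \<le> h x"
      by eventually_elim (rule SUP_least, blast)
  qed auto
  with JC that show thesis by (auto simp: C_def)
qed

lemma is_ess_sup_le:
  "is_ess_sup M I f g \<Longrightarrow> is_ess_sup M I f h \<Longrightarrow> AE x in M. g x \<le> h x"
  unfolding is_ess_sup_def by blast

lemma (in finite_measure) ess_sup_is_ess_sup:
  assumes "\<And>i. i \<in> I \<Longrightarrow> f i \<in> borel_measurable M"
  shows "is_ess_sup M I f (ess_sup M I f)"
proof -
  obtain J where "is_ess_sup M I f (\<lambda>x. SUP i\<in>J. ereal (f i x))"
    by (rule countable_ess_sup[of I f, OF assms])
  then show ?thesis unfolding ess_sup_def by (rule someI[of "is_ess_sup M I f"])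
qed

lemma (in finite_measure) ess_sup_upper:
  assumes "\<And>i. i \<in> I \<Longrightarrow> f i \<in> borel_measurable M" "i \<in> I"
  shows "AE x in M. ereal (f i x) \<le> ess_sup M I f x"
  using ess_sup_is_ess_sup[of I f, OF assms(1)] assms(2) unfolding is_ess_sup_def by blast

lemma (in finite_measure) ess_sup_least:
  assumes "\<And>i. i \<in> I \<Longrightarrow> f i \<in> borel_measurable M" "h \<in> borel_measurable M"
    and "\<And>i. i \<in> I \<Longrightarrow> AE x in M. ereal (f i x) \<le> h x"
  shows "AE x in M. ess_sup M I f x \<le> h x"
  using ess_sup_is_ess_sup[of I f, OF assms(1)] assms(2,3) unfolding is_ess_sup_def by blast

lemma (in finite_measure) ess_sup_measurable:
  assumes "\<And>i. i \<in> I \<Longrightarrow> f i \<in> borel_measurable M"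
  shows "ess_sup M I f \<in> borel_measurable M"
  using ess_sup_is_ess_sup[of I f, OF assms(1)] unfolding is_ess_sup_def by blast

lemma (in finite_measure) ess_sup_eq_countable_SUP:
  assumes "\<And>i. i \<in> I \<Longrightarrow> f i \<in> borel_measurable M"
  obtains J where "countable J" "J \<subseteq> I"
    "AE x in M. ess_sup M I f x = (SUP i\<in>J. ereal (f i x))"
proof -
  obtain J where J: "countable J" "J \<subseteq> I" "is_ess_sup M I f (\<lambda>x. SUP i\<in>J. ereal (f i x))"
    by (rule countable_ess_sup[of I f, OF assms])
  note E = ess_sup_is_ess_sup[of I f, OF assms]
  have "AE x in M. ess_sup M I f x \<le> (SUP i\<in>J. ereal (f i x))"
    using E J(3) by (rule is_ess_sup_le)
  moreover have "AE x in M. (SUP i\<in>J. ereal (f i x)) \<le> ess_sup M I f x"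
    using J(3) E by (rule is_ess_sup_le)
  ultimately  have "AE x in M. ess_sup M I f x = (SUP i\<in>J. ereal (f i x))"
    by eventually_elim (rule antisym)
  with J(1,2) that show thesis by blast
qed

text \<open>
  Enumerate a countable subfamily that realises the essential supremum and pick, one after the other,
  a member of the family above both the current choice and the next one in the enumeration.
\<close>

lemma (in finite_measure) ess_sup_directed_limit:
  assumes meas: "\<And>i. i \<in> I \<Longrightarrow> f i \<in> borel_measurable M" and ne: "I \<noteq> {}"
    and dir: "\<And>i j. i \<in> I \<Longrightarrow> j \<in> I \<Longrightarrow> \<exists>k\<in>I. AE x in M. f i x \<le> f k x \<and> f j x \<le> f k x"
  obtains s :: "nat \<Rightarrow> 'i" where "\<And>n. s n \<in> I"
    "\<And>n. AE x in M. f (s n) x \<le> f (s (Suc n)) x"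
    "AE x in M. (\<lambda>n. ereal (f (s n) x)) \<longlonglongrightarrow> ess_sup M I f x"
proof -
  obtain J where J: "countable J" "J \<subseteq> I" "AE x in M. ess_sup M I f x = (SUP i\<in>J. ereal (f i x))"
    by (rule ess_sup_eq_countable_SUP[of I f, OF meas])
  obtain i0 where i0: "i0 \<in> I" using ne by auto
  define e where "e = from_nat_into (insert i0 J)"
  have e: "e n \<in> I" for n
    using from_nat_into[of "insert i0 J" n] i0 J(2) by (auto simp: e_def)
  have e_surj: "\<exists>n. e n = j" if "j \<in> J" for j
    using that J(1) from_nat_into_surj[of "insert i0 J" j] by (auto simp: e_def)
  obtain k where k: "\<And>i j. i \<in> I \<Longrightarrow> j \<in> I \<Longrightarrow> k i j \<in> I"
    "\<And>i j. i \<in> I \<Longrightarrow> j \<in> I \<Longrightarrow> AE x in M. f i x \<le> f (k i j) x \<and> f j x \<le> f (k i j) x"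
    using dir by metis
  define s where "s = rec_nat (e 0) (\<lambda>n i. k i (e (Suc n)))"
  have s_simps: "s 0 = e 0" "\<And>n. s (Suc n) = k (s n) (e (Suc n))" by (auto simp: s_def)
  have sI: "s n \<in> I" for n by (induction n) (auto simp: s_simps k e)
  have step: "AE x in M. f (s n) x \<le> f (s (Suc n)) x" for n
    using k(2)[OF sI e, of n "Suc n"] by (auto simp: s_simps)
  have e_le: "AE x in M. f (e n) x \<le> f (s n) x" for n
    using k(2)[OF sI e, of "n - 1" n] by (cases n) (auto simp: s_simps)
  have "AE x in M. \<forall>n. f (s n) x \<le> f (s (Suc n)) x" "AE x in M. \<forall>n. f (e n) x \<le> f (s n) x"
    "AE x in M. \<forall>n. ereal (f (s n) x) \<le> ess_sup M I f x"
    using step e_le ess_sup_upper[of I f, OF meas sI] by (auto simp: AE_all_countable)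
  then have "AE x in M. (\<lambda>n. ereal (f (s n) x)) \<longlonglongrightarrow> ess_sup M I f x"
    using J(3)
  proof eventually_elim
    case (elim x)
    have "incseq (\<lambda>n. ereal (f (s n) x))" using elim(1) by (intro incseq_SucI) simp
    then have "(\<lambda>n. ereal (f (s n) x)) \<longlonglongrightarrow> (SUP n. ereal (f (s n) x))" by (rule LIMSEQ_SUP)
    moreover have "(SUP n. ereal (f (s n) x)) = ess_sup M I f x"
    proof (rule antisym)
      show "(SUP n. ereal (f (s n) x)) \<le> ess_sup M I f x" using elim(3) by (auto intro: SUP_least)
      show "ess_sup M I f x \<le> (SUP n. ereal (f (s n) x))"
        unfolding elim(4)
      proof (rule SUP_least)
        fix j assume "j \<in> J"
        then obtain n where "e n = j" using e_surj by blast
        then have "ereal (f j x) \<le> ereal (f (s n) x)" using elim(2) by auto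
        also have "\<dots> \<le> (SUP n. ereal (f (s n) x))" by (rule SUP_upper) simp
        finally show "ereal (f j x) \<le> (SUP n. ereal (f (s n) x))" .
      qed
    qed
    ultimately show ?case by simp
  qed
  with sI step that show thesis by blast
qed

text \<open>
  All membership proofs for \<open>L\<^sup>p\<close> below go by comparison with two known elements, since the random
  variables involved are either pasted from two others or squeezed between them.
\<close>

lemma Lp_dominated:
  assumes g: "g \<in> Lp M p G" "h \<in> Lp M p H"
    and f: "f \<in> borel_measurable N" "f \<in> borel_measurable M"
    and le: "AE x in M. \<bar>f x\<bar> \<le> max \<bar>g x\<bar> \<bar>h x\<bar>"
  shows "f \<in> Lp M p N"
proof (cases "p = \<infinity>")
  case True
  with g obtain C D where "AE x in M. \<bar>g x\<bar> \<le> C" "AE x in M. \<bar>h x\<bar> \<le> D"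
    by (auto simp: Lp_def)
  then have "AE x in M. \<bar>f x\<bar> \<le> max C D" using le by eventually_elim auto
  with True f show ?thesis by (auto simp: Lp_def)
next
  case False
  then have int: "integrable M (\<lambda>x. \<bar>g x\<bar> powr enn2real p + \<bar>h x\<bar> powr enn2real p)"
    using g by (auto simp: Lp_def)
  have "integrable M (\<lambda>x. \<bar>f x\<bar> powr enn2real p)"
  proof (rule Bochner_Integration.integrable_bound[OF int])
    show "(\<lambda>x. \<bar>f x\<bar> powr enn2real p) \<in> borel_measurable M" using f(2) by measurable
    show "AE x in M. norm (\<bar>f x\<bar> powr enn2real p)
        \<le> norm (\<bar>g x\<bar> powr enn2real p + \<bar>h x\<bar> powr enn2real p)"
      using le
    proof eventually_elim
      case (elim x)
      have "\<bar>f x\<bar> powr enn2real p \<le> (max \<bar>g x\<bar> \<bar>h x\<bar>) powr enn2real p"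
        using elim by (intro powr_mono2) auto
      also have "\<dots> \<le> \<bar>g x\<bar> powr enn2real p + \<bar>h x\<bar> powr enn2real p"
        by (auto simp: max_def)
      finally show ?case by simp
    qed
  qed
  with False f show ?thesis by (auto simp: Lp_def)
qed


section \<open>Sigma-algebras of stopping times and Bermudan times\<close>

context bermudan_setting
begin

lemma stopping_timesD:
  assumes "\<tau> \<in> stopping_times M F T"
  shows "stopping_time F \<tau>" "x \<in> space M \<Longrightarrow> 0 \<le> \<tau> x" "x \<in> space M \<Longrightarrow> \<tau> x \<le> T"
  using assms by (auto simp: stopping_times_def)

lemma null_set_in_F:
  assumes "N \<in> null_sets M" "0 \<le> t"
  shows "N \<in> sets (F t)"
  using assms F_complete sets_F_mono[of 0 t] by auto

lemma pre_sigma_sub_F_T: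
  assumes "\<tau> \<in> stopping_times M F T"
  shows "sets (pre_sigma \<tau>) \<subseteq> sets (F T)"
proof
  fix B assume B: "B \<in> sets (pre_sigma \<tau>)"
  then have "B \<subseteq> space M" using sets.sets_into_space space_pre_sigma by metis
  then have "{x \<in> B. \<tau> x \<le> T} = B" using stopping_timesD[OF assms] by auto
  with sets_pre_sigmaD[OF stopping_timesD(1)[OF assms] B, of T] show "B \<in> sets (F T)" by simp
qed

lemma pre_sigma_sub_M:
  assumes "\<tau> \<in> stopping_times M F T"
  shows "sets (pre_sigma \<tau>) \<subseteq> sets M"
  using pre_sigma_sub_F_T[OF assms] F_sub[of T] T_pos by auto

lemma measurable_pre_sigma_M:
  assumes "\<tau> \<in> stopping_times M F T" "f \<in> borel_measurable (pre_sigma \<tau>)"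
  shows "f \<in> borel_measurable M"
  using measurable_mono[of borel borel "pre_sigma \<tau>" M] pre_sigma_sub_M[OF assms(1)] assms(2)
  by (auto simp: space_pre_sigma)

text \<open>
  Completeness of the filtration passes to the sigma-algebra of a stopping time.  This is what
  allows the order between stopping times, and the equality of random variables, to hold only almost
  surely in the measurability statements that follow.
\<close>

lemma null_set_in_pre_sigma:
  assumes \<tau>: "\<tau> \<in> stopping_times M F T" and N: "N \<in> null_sets M"
  shows "N \<in> sets (pre_sigma \<tau>)"
proof (rule sets_pre_sigmaI[OF stopping_timesD(1)[OF \<tau>]])
  fix t
  show "{x \<in> N. \<tau> x \<le> t} \<in> sets (F t)"
  proof (cases "0 \<le> t")
    case True
    have "{x \<in> N. \<tau> x \<le> t} \<in> null_sets M" using N by (auto intro: complete2)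
    then show ?thesis using True by (rule null_set_in_F)
  next
    case False
    have "N \<subseteq> space M" using N sets.sets_into_space by auto
    then have "{x \<in> N. \<tau> x \<le> t} = {}" using False stopping_timesD(2)[OF \<tau>] by fastforce
    then show ?thesis by (metis sets.empty_sets)
  qed
qed

lemma pre_sigma_mono_AE:
  assumes \<sigma>: "\<sigma> \<in> stopping_times M F T" and \<tau>: "\<tau> \<in> stopping_times M F T"
    and le: "AE x in M. \<sigma> x \<le> \<tau> x"
  shows "sets (pre_sigma \<sigma>) \<subseteq> sets (pre_sigma \<tau>)"
proof
  fix B assume B: "B \<in> sets (pre_sigma \<sigma>)"
  let ?N = "{x \<in> space M. \<not> \<sigma> x \<le> \<tau> x}"
  have N: "?N \<in> null_sets M" using le by (simp add: AE_iff_null_sets)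
  have Bsp: "B \<subseteq> space M" using B sets.sets_into_space space_pre_sigma by metis
  have "B - ?N \<in> sets (pre_sigma \<tau>)"
  proof (rule sets_pre_sigmaI[OF stopping_timesD(1)[OF \<tau>]])
    fix t
    have "{x \<in> B - ?N. \<tau> x \<le> t} = ({x \<in> B. \<sigma> x \<le> t} \<inter> {x \<in> space (F t). \<tau> x \<le> t}) - {x \<in> ?N. \<tau> x \<le> t}"
      using Bsp by (auto simp: space_F)
    moreover have "{x \<in> B. \<sigma> x \<le> t} \<in> sets (F t)"
      using sets_pre_sigmaD[OF stopping_timesD(1)[OF \<sigma>] B] .
    moreover have "{x \<in> space (F t). \<tau> x \<le> t} \<in> sets (F t)"
      using stopping_timeD[OF stopping_timesD(1)[OF \<tau>], of t] by (simp add: pred_def)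
    moreover have "{x \<in> ?N. \<tau> x \<le> t} \<in> sets (F t)"
      using sets_pre_sigmaD[OF stopping_timesD(1)[OF \<tau>] null_set_in_pre_sigma[OF \<tau> N]] .
    ultimately show "{x \<in> B - ?N. \<tau> x \<le> t} \<in> sets (F t)" by auto
  qed
  moreover have "B \<inter> ?N \<in> sets (pre_sigma \<tau>)"
    using N by (intro null_set_in_pre_sigma[OF \<tau>]) (auto intro: complete2)
  ultimately have "(B - ?N) \<union> (B \<inter> ?N) \<in> sets (pre_sigma \<tau>)" by (rule sets.Un)
  then show "B \<in> sets (pre_sigma \<tau>)" by (simp only: Un_Diff_Int)
qed

lemma measurable_pre_sigma_mono:
  assumes "\<sigma> \<in> stopping_times M F T" "\<tau> \<in> stopping_times M F T" "AE x in M. \<sigma> x \<le> \<tau> x"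
    and "f \<in> borel_measurable (pre_sigma \<sigma>)"
  shows "f \<in> borel_measurable (pre_sigma \<tau>)"
  using measurable_mono[of borel borel "pre_sigma \<sigma>" "pre_sigma \<tau>"]
    pre_sigma_mono_AE[OF assms(1-3)] assms(4) by (auto simp: space_pre_sigma)

lemma measurable_pre_sigma_AE_cong:
  assumes \<tau>: "\<tau> \<in> stopping_times M F T" and f: "f \<in> borel_measurable (pre_sigma \<tau>)"
    and eq: "AE x in M. f x = g x"
  shows "g \<in> borel_measurable (pre_sigma \<tau>)"
proof (rule measurableI)
  fix B :: "'b set" assume B: "B \<in> sets borel"
  let ?N = "{x \<in> space M. \<not> f x = g x}"
  have N: "?N \<in> null_sets M" using eq by (simp add: AE_iff_null_sets)
  have "f -` B \<inter> space (pre_sigma \<tau>) - ?N \<in> sets (pre_sigma \<tau>)"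
    using measurable_sets[OF f B] null_set_in_pre_sigma[OF \<tau> N] by (rule sets.Diff)
  moreover have "g -` B \<inter> ?N \<in> sets (pre_sigma \<tau>)"
    using N by (intro null_set_in_pre_sigma[OF \<tau>]) (auto intro: complete2)
  ultimately have "(f -` B \<inter> space (pre_sigma \<tau>) - ?N) \<union> (g -` B \<inter> ?N) \<in> sets (pre_sigma \<tau>)"
    by (rule sets.Un)
  also have "(f -` B \<inter> space (pre_sigma \<tau>) - ?N) \<union> (g -` B \<inter> ?N) = g -` B \<inter> space (pre_sigma \<tau>)"
    by (auto simp: space_pre_sigma)
  finally show "g -` B \<inter> space (pre_sigma \<tau>) \<in> sets (pre_sigma \<tau>)" .
qed simp

text \<open>
  On the event \<open>{\<tau> \<le> t}\<close> the equality of the two times can be read off from the times capped at \<open>t\<close>,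
  which are known at time \<open>t\<close>.
\<close>

lemma stopping_time_eq_trace:
  assumes \<sigma>: "stopping_time F \<sigma>" and \<tau>: "stopping_time F \<tau>" and B: "B \<in> sets (pre_sigma \<sigma>)"
  shows "{x \<in> B. \<sigma> x = \<tau> x} \<in> sets (pre_sigma \<tau>)"
proof (rule sets_pre_sigmaI[OF \<tau>])
  fix t
  have capped: "(\<lambda>x. min (\<nu> x) t) \<in> borel_measurable (F t)" if \<nu>: "stopping_time F \<nu>" for \<nu>
  proof (rule borel_measurableI_le)
    fix a
    show "{x \<in> space (F t). min (\<nu> x) t \<le> a} \<in> sets (F t)"
    proof (cases "t \<le> a")
      case True
      then have "{x \<in> space (F t). min (\<nu> x) t \<le> a} = space (F t)" by auto
      then show ?thesis by simp
    next
      case False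
      then have "{x \<in> space (F t). min (\<nu> x) t \<le> a} = {x \<in> space (F t). \<nu> x \<le> a}" by auto
      then show ?thesis using stopping_time_le_const[OF \<nu>, of a t] False by (simp add: pred_def)
    qed
  qed
  have Bsp: "B \<subseteq> space M" using B sets.sets_into_space space_pre_sigma by metis
  have "{x \<in> space (F t). min (\<sigma> x) t = min (\<tau> x) t} \<in> sets (F t)"
    using capped[OF \<sigma>] capped[OF \<tau>] by measurable
  moreover have "{x \<in> B. \<sigma> x \<le> t} \<in> sets (F t)" using sets_pre_sigmaD[OF \<sigma> B] .
  moreover have "{x \<in> space (F t). \<tau> x \<le> t} \<in> sets (F t)"
    using stopping_timeD[OF \<tau>, of t] by (simp add: pred_def)
  moreover have "{x \<in> {x \<in> B. \<sigma> x = \<tau> x}. \<tau> x \<le> t} =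
    {x \<in> B. \<sigma> x \<le> t} \<inter> {x \<in> space (F t). \<tau> x \<le> t} \<inter>
    {x \<in> space (F t). min (\<sigma> x) t = min (\<tau> x) t}"
    using Bsp by (auto simp: space_F)
  ultimately show "{x \<in> {x \<in> B. \<sigma> x = \<tau> x}. \<tau> x \<le> t} \<in> sets (F t)" by auto
qed

lemma stopping_time_eq_event:
  assumes "stopping_time F \<sigma>" "stopping_time F \<tau>"
  shows "{x \<in> space M. \<sigma> x = \<tau> x} \<in> sets (pre_sigma \<tau>)"
  using stopping_time_eq_trace[OF assms, of "space M"] sets.top[of "pre_sigma \<sigma>"]
  by (simp add: space_pre_sigma)

text \<open>
  Information available at \<open>\<sigma>\<close> may be used at \<open>\<tau>\<close> where the two times coincide.  This gives the
  measurability of families that single out the event that the running time meets a given one.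
\<close>

lemma measurable_on_stopping_time_eq:
  fixes f :: "'a \<Rightarrow> real"
  assumes \<sigma>: "stopping_time F \<sigma>" and \<tau>: "stopping_time F \<tau>"
    and f: "f \<in> borel_measurable (pre_sigma \<sigma>)" and g: "g \<in> borel_measurable (pre_sigma \<tau>)"
  shows "(\<lambda>x. if \<tau> x = \<sigma> x then f x else g x) \<in> borel_measurable (pre_sigma \<tau>)"
proof (rule measurableI)
  fix B :: "real set" assume B: "B \<in> sets borel"
  let ?E = "{x \<in> space M. \<sigma> x = \<tau> x}"
  have 1: "{x \<in> f -` B \<inter> space (pre_sigma \<sigma>). \<sigma> x = \<tau> x} \<in> sets (pre_sigma \<tau>)"
    by (rule stopping_time_eq_trace[OF \<sigma> \<tau> measurable_sets[OF f B]])
  have 2: "g -` B \<inter> space (pre_sigma \<tau>) - ?E \<in> sets (pre_sigma \<tau>)"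
    by (rule sets.Diff[OF measurable_sets[OF g B] stopping_time_eq_event[OF \<sigma> \<tau>]])
  have "(\<lambda>x. if \<tau> x = \<sigma> x then f x else g x) -` B \<inter> space (pre_sigma \<tau>) =
    {x \<in> f -` B \<inter> space (pre_sigma \<sigma>). \<sigma> x = \<tau> x} \<union> (g -` B \<inter> space (pre_sigma \<tau>) - ?E)"
    by (auto simp: space_pre_sigma split: if_splits)
  with sets.Un[OF 1 2]
  show "(\<lambda>x. if \<tau> x = \<sigma> x then f x else g x) -` B \<inter> space (pre_sigma \<tau>) \<in> sets (pre_sigma \<tau>)"
    by simp
qed simp

lemma theta_increasing: "j \<le> k \<Longrightarrow> AE x in M. \<theta> j x \<le> \<theta> k x"
proof (induction rule: dec_induct)
  case (step n)
  from step.IH theta_mono[of n] show ?case by eventually_elim auto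
qed simp

text \<open>
  The partition can be recovered from the values: the event that \<open>k\<close> is the first index with \<open>\<tau> = \<theta> k\<close>
  is known at time \<open>\<theta> k\<close>, and off all these events \<open>\<tau> = T\<close> almost surely.
  In this form the closure of the class under pasting, maxima and minima is a pointwise statement.
\<close>

lemma Theta_iff:
  "\<tau> \<in> Theta \<longleftrightarrow> \<tau> \<in> stopping_times M F T \<and> (AE x in M. \<tau> x = T \<or> (\<exists>k. \<tau> x = \<theta> k x))"
proof
  assume "\<tau> \<in> Theta"
  then obtain A B where \<tau>: "\<tau> \<in> stopping_times M F T" and dis: "disjoint_family A"
    and AB: "(\<Union>k. A k) \<inter> B = {}" "(\<Union>k. A k) \<union> B = space M"
    and eq: "AE x in M. \<tau> x = (\<Sum>k. \<theta> k x * indicator (A k) x) + T * indicator B x"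
    unfolding bermudan_times_def by blast
  have "AE x in M. \<tau> x = T \<or> (\<exists>k. \<tau> x = \<theta> k x)"
    using eq AE_space
  proof eventually_elim
    case (elim x)
    show ?case
    proof (cases "x \<in> B")
      case True
      then have "x \<notin> A k" for k using AB(1) by blast
      then have "(\<lambda>k. \<theta> k x * indicator (A k) x) = (\<lambda>k. 0)" by simp
      then show ?thesis using elim True by simp
    next
      case False
      then obtain k where k: "x \<in> A k" using AB(2) elim(2) by auto
      have "(\<lambda>j. \<theta> j x * indicator (A j) x) = (\<lambda>j. if j = k then \<theta> j x else 0)"
        using k dis by (auto simp: indicator_def disjoint_family_on_def fun_eq_iff)
      then have "(\<Sum>j. \<theta> j x * indicator (A j) x) = \<theta> k x"
        using sums_unique[OF sums_single[of k "\<lambda>j. \<theta> j x"]] by simp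
      then show ?thesis using elim False by auto
    qed
  qed
  with \<tau> show "\<tau> \<in> stopping_times M F T \<and> (AE x in M. \<tau> x = T \<or> (\<exists>k. \<tau> x = \<theta> k x))" by blast
next
  assume "\<tau> \<in> stopping_times M F T \<and> (AE x in M. \<tau> x = T \<or> (\<exists>k. \<tau> x = \<theta> k x))"
  then have \<tau>: "\<tau> \<in> stopping_times M F T" and AE: "AE x in M. \<tau> x = T \<or> (\<exists>k. \<tau> x = \<theta> k x)"
    by auto
  define E where "E k = {x \<in> space M. \<tau> x = \<theta> k x}" for k
  \<comment> \<open>Disjointing assigns each point to the first index at which \<open>\<tau>\<close> meets the exercise time.\<close>
  define A where "A = disjointed E"
  define B where "B = space M - (\<Union>k. A k)"
  have E_sets: "E j \<in> sets (pre_sigma (\<theta> k))" if "j \<le> k" for j k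
    using stopping_time_eq_event[OF stopping_timesD(1)[OF \<tau>] stopping_timesD(1)[OF theta_stopping]]
      pre_sigma_mono_AE[OF theta_stopping theta_stopping theta_increasing[OF that]]
    by (auto simp: E_def)
  have A_sets: "A k \<in> sets (pre_sigma (\<theta> k))" for k
    unfolding A_def disjointed_def using E_sets by (intro sets.Diff sets.finite_UN) auto
  have A_sub: "A k \<subseteq> E k" for k by (simp add: A_def disjointed_subset)
  have UN: "(\<Union>k. A k) = (\<Union>k. E k)" by (simp add: A_def UN_disjointed_eq)
  have dis: "disjoint_family A" by (simp add: A_def disjoint_family_disjointed)
  have spF: "space M \<in> sets (F T)" using sets.top[of "F T"] by (simp add: space_F)
  have B_sets: "B \<in> sets (F T)"
    unfolding B_def using A_sets pre_sigma_sub_F_T[OF theta_stopping] spF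
    by (intro sets.Diff sets.countable_UN) auto
  have eq: "AE x in M. \<tau> x = (\<Sum>k. \<theta> k x * indicator (A k) x) + T * indicator B x"
    using AE AE_space
  proof eventually_elim
    case (elim x)
    show ?case
    proof (cases "x \<in> B")
      case True
      then have "(\<lambda>k. \<theta> k x * indicator (A k) x) = (\<lambda>k. 0)" by (auto simp: indicator_def B_def)
      moreover have "\<tau> x = T" using True elim by (auto simp: B_def UN E_def)
      ultimately show ?thesis using True by simp
    next
      case False
      then obtain k where k: "x \<in> A k" using elim by (auto simp: B_def)
      have "(\<lambda>j. \<theta> j x * indicator (A j) x) = (\<lambda>j. if j = k then \<theta> j x else 0)"
        using k dis by (auto simp: indicator_def disjoint_family_on_def fun_eq_iff)
      moreover have "\<tau> x = \<theta> k x" using k A_sub[of k] by (auto simp: E_def)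
      ultimately show ?thesis using False sums_unique[OF sums_single[of k "\<lambda>j. \<theta> j x"]] by auto
    qed
  qed
  have "(\<Union>k. A k) \<inter> B = {}" "(\<Union>k. A k) \<union> B = space M"
    using A_sub by (auto simp: B_def E_def)
  with \<tau> dis A_sets B_sets eq show "\<tau> \<in> Theta"
    unfolding bermudan_times_def by blast
qed

lemma Theta_stopping_times: "\<tau> \<in> Theta \<Longrightarrow> \<tau> \<in> stopping_times M F T"
  by (simp add: Theta_iff)

lemma Theta_stopping_time: "\<tau> \<in> Theta \<Longrightarrow> stopping_time F \<tau>"
  by (simp add: Theta_stopping_times stopping_timesD)

lemma Theta_glue:
  assumes \<sigma>: "\<sigma> \<in> Theta" and \<tau>: "\<tau> \<in> Theta"
    and C: "C \<in> sets (pre_sigma \<sigma>)" "C \<in> sets (pre_sigma \<tau>)"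
  shows "(\<lambda>x. if x \<in> C then \<sigma> x else \<tau> x) \<in> Theta" (is "?g \<in> _")
  unfolding Theta_iff
proof
  have st: "stopping_time F \<sigma>" "stopping_time F \<tau>" using \<sigma> \<tau> by (auto simp: Theta_stopping_time)
  have "stopping_time F ?g"
  proof (rule stopping_timeI)
    fix t
    have "{x \<in> space M - C. \<tau> x \<le> t} \<in> sets (F t)"
      using sets.compl_sets[OF C(2)] by (intro sets_pre_sigmaD[OF st(2)]) (simp add: space_pre_sigma)
    with sets_pre_sigmaD[OF st(1) C(1)]
    have "{x \<in> C. \<sigma> x \<le> t} \<union> {x \<in> space M - C. \<tau> x \<le> t} \<in> sets (F t)" by (rule sets.Un)
    also have "{x \<in> C. \<sigma> x \<le> t} \<union> {x \<in> space M - C. \<tau> x \<le> t} = {x \<in> space (F t). ?g x \<le> t}"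
      using sets.sets_into_space[OF C(1)] by (auto simp: space_F space_pre_sigma)
    finally show "Measurable.pred (F t) (\<lambda>x. ?g x \<le> t)" by (simp add: pred_def)
  qed
  then show "?g \<in> stopping_times M F T"
    using stopping_timesD[OF Theta_stopping_times[OF \<sigma>]] stopping_timesD[OF Theta_stopping_times[OF \<tau>]]
    by (auto simp: stopping_times_def)
  have "AE x in M. \<sigma> x = T \<or> (\<exists>k. \<sigma> x = \<theta> k x)" "AE x in M. \<tau> x = T \<or> (\<exists>k. \<tau> x = \<theta> k x)"
    using \<sigma> \<tau> by (auto simp: Theta_iff)
  then show "AE x in M. ?g x = T \<or> (\<exists>k. ?g x = \<theta> k x)" by eventually_elim auto
qed

lemma Theta_sup:
  assumes "\<sigma> \<in> Theta" "\<tau> \<in> Theta"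
  shows "sup \<sigma> \<tau> \<in> Theta"
proof -
  have "sup \<sigma> \<tau> = (\<lambda>x. max (\<sigma> x) (\<tau> x))" by (simp add: sup_fun_def sup_max)
  moreover have "AE x in M. max (\<sigma> x) (\<tau> x) = T \<or> (\<exists>k. max (\<sigma> x) (\<tau> x) = \<theta> k x)"
    using conjunct2[OF assms(1)[unfolded Theta_iff]] conjunct2[OF assms(2)[unfolded Theta_iff]]
    by eventually_elim (auto simp: max_def)
  ultimately show ?thesis
    using assms unfolding Theta_iff by (auto simp: stopping_times_def stopping_time_max le_max_iff_disj)
qed

lemma Theta_inf:
  assumes "\<sigma> \<in> Theta" "\<tau> \<in> Theta"
  shows "inf \<sigma> \<tau> \<in> Theta"
proof -
  have "inf \<sigma> \<tau> = (\<lambda>x. min (\<sigma> x) (\<tau> x))" by (simp add: inf_fun_def inf_min)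
  moreover have "AE x in M. min (\<sigma> x) (\<tau> x) = T \<or> (\<exists>k. min (\<sigma> x) (\<tau> x) = \<theta> k x)"
    using conjunct2[OF assms(1)[unfolded Theta_iff]] conjunct2[OF assms(2)[unfolded Theta_iff]]
    by eventually_elim (auto simp: min_def)
  ultimately show ?thesis
    using assms unfolding Theta_iff by (auto simp: stopping_times_def stopping_time_min min_le_iff_disj)
qed

end


section \<open>Locality of the evaluation\<close>

context nonlinear_evaluation
begin

lemma Theta_fromI: "\<tau> \<in> Theta \<Longrightarrow> AE x in M. R x \<le> \<tau> x \<Longrightarrow> \<tau> \<in> Theta_from R"
  by (simp add: times_from_def)

lemma Theta_fromD:
  assumes "\<tau> \<in> Theta_from R"
  shows "\<tau> \<in> Theta" "AE x in M. R x \<le> \<tau> x"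
  using assms by (auto simp: times_from_def)

lemma Theta_from_self: "R \<in> Theta \<Longrightarrow> R \<in> Theta_from R"
  by (simp add: times_from_def)

lemma Theta_from_trans:
  assumes "R \<in> Theta_from S" "\<tau> \<in> Theta_from R"
  shows "\<tau> \<in> Theta_from S"
proof (rule Theta_fromI[OF Theta_fromD(1)[OF assms(2)]])
  show "AE x in M. S x \<le> \<tau> x"
    using Theta_fromD(2)[OF assms(1)] Theta_fromD(2)[OF assms(2)] by eventually_elim auto
qed

lemma Theta_from_sup1:
  assumes "\<sigma> \<in> Theta_from R" "\<tau> \<in> Theta"
  shows "sup \<sigma> \<tau> \<in> Theta_from R"
proof (rule Theta_fromI[OF Theta_sup[OF Theta_fromD(1)[OF assms(1)] assms(2)]])
  show "AE x in M. R x \<le> sup \<sigma> \<tau> x"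
    using Theta_fromD(2)[OF assms(1)] by eventually_elim (auto simp: le_supI1)
qed

lemma Theta_borel: "\<tau> \<in> Theta \<Longrightarrow> \<tau> \<in> borel_measurable M"
  using measurable_pre_sigma_M[OF Theta_stopping_times
      measurable_stopping_time_pre_sigma[OF Theta_stopping_time]] by blast

lemma Lp_borel: "\<tau> \<in> Theta \<Longrightarrow> \<eta> \<in> Lp M p (pre_sigma \<tau>) \<Longrightarrow> \<eta> \<in> borel_measurable M"
  using measurable_pre_sigma_M[OF Theta_stopping_times] by (auto simp: Lp_def)

lemma Lp_pre_sigma_mono:
  assumes "\<sigma> \<in> Theta" "\<tau> \<in> Theta" "AE x in M. \<sigma> x \<le> \<tau> x" "\<eta> \<in> Lp M p (pre_sigma \<sigma>)"
  shows "\<eta> \<in> Lp M p (pre_sigma \<tau>)"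
  using assms(4) measurable_pre_sigma_mono[OF assms(1,2)[THEN Theta_stopping_times] assms(3)]
  by (auto simp: Lp_def)

lemma rho_AE_cong:
  assumes "S \<in> Theta" "\<tau> \<in> Theta" "\<eta>1 \<in> Lp M p (pre_sigma \<tau>)" "\<eta>2 \<in> Lp M p (pre_sigma \<tau>)"
    and eq: "AE x in M. \<eta>1 x = \<eta>2 x"
  shows "AE x in M. \<rho> S \<tau> \<eta>1 x = \<rho> S \<tau> \<eta>2 x"
proof -
  have "AE x in M. \<eta>1 x \<le> \<eta>2 x" "AE x in M. \<eta>2 x \<le> \<eta>1 x" using eq by (auto elim: eventually_mono)
  with rho_mono[OF assms(1-4)] rho_mono[OF assms(1,2,4,3)]
  have "AE x in M. \<rho> S \<tau> \<eta>1 x \<le> \<rho> S \<tau> \<eta>2 x" "AE x in M. \<rho> S \<tau> \<eta>2 x \<le> \<rho> S \<tau> \<eta>1 x" by auto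
  then show ?thesis by eventually_elim (rule antisym)
qed

text \<open>
  If \<open>\<sigma> = \<tau>\<close> almost surely, then \<open>\<rho> \<sigma> \<tau> \<eta> = \<eta>\<close> by knowledge preservation, and consistency
  inserts this intermediate evaluation.
\<close>

lemma rho_time_AE_cong:
  assumes S: "S \<in> Theta" and \<sigma>: "\<sigma> \<in> Theta_from S" and \<tau>: "\<tau> \<in> Theta_from S"
    and eq: "AE x in M. \<sigma> x = \<tau> x" and \<eta>: "\<eta> \<in> Lp M p (pre_sigma \<tau>)"
  shows "AE x in M. \<rho> S \<sigma> \<eta> x = \<rho> S \<tau> \<eta> x"
proof -
  note \<sigma>T = Theta_fromD(1)[OF \<sigma>] and \<tau>T = Theta_fromD(1)[OF \<tau>]
  have le: "AE x in M. \<sigma> x \<le> \<tau> x" "AE x in M. \<tau> x \<le> \<sigma> x" using eq by (auto elim: eventually_mono)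
  have "AE x in M. \<rho> S \<sigma> (\<rho> \<sigma> \<tau> \<eta>) x = \<rho> S \<tau> \<eta> x"
    by (rule rho_consistent[OF S \<sigma>T \<tau>T Theta_fromD(2)[OF \<sigma>] le(1) \<eta>])
  moreover have "AE x in M. \<rho> S \<sigma> (\<rho> \<sigma> \<tau> \<eta>) x = \<rho> S \<sigma> \<eta> x"
    by (intro rho_AE_cong S \<sigma>T rho_Lp \<tau>T \<eta> Lp_pre_sigma_mono[OF \<tau>T \<sigma>T le(2)]
        rho_knowledge Theta_fromI le(2))
  ultimately show ?thesis by eventually_elim simp
qed

text \<open>
  The zero-one law compares two payoffs only if they belong to one family indexed by a single time.
  Here it is the family that pays \<open>\<eta>\<close> where the running time meets \<open>\<tau>\<close>, \<open>\<zeta>\<close> where it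
  meets \<open>R\<close>, and \<open>0\<close> elsewhere.  The two prescriptions collide on \<open>{\<tau> = R}\<close>, whence the hypothesis that
  \<open>\<eta>\<close> and \<open>\<zeta>\<close> agree there.
\<close>

lemma rho_stop_off_event:
  assumes R: "R \<in> Theta" and \<tau>: "\<tau> \<in> Theta_from R" and A: "A \<in> sets (pre_sigma R)"
    and \<eta>: "\<eta> \<in> Lp M p (pre_sigma \<tau>)" and \<zeta>: "\<zeta> \<in> Lp M p (pre_sigma R)"
    and agree: "AE x in M. \<tau> x = R x \<longrightarrow> \<eta> x = \<zeta> x"
  defines "\<kappa> \<equiv> \<lambda>x. if x \<in> A then \<tau> x else R x" and "\<omega> \<equiv> \<lambda>x. if x \<in> A then \<eta> x else \<zeta> x"
  shows "\<kappa> \<in> Theta_from R" "\<omega> \<in> Lp M p (pre_sigma \<kappa>)"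
    "AE x in M. x \<in> A \<longrightarrow> \<rho> R \<tau> \<eta> x = \<rho> R \<kappa> \<omega> x"
proof -
  note \<tau>T = Theta_fromD(1)[OF \<tau>]
  have "A \<in> sets (pre_sigma \<tau>)"
    using A pre_sigma_mono_AE[OF Theta_stopping_times[OF R] Theta_stopping_times[OF \<tau>T] Theta_fromD(2)[OF \<tau>]]
    by auto
  then have \<kappa>T: "\<kappa> \<in> Theta" unfolding \<kappa>_def using Theta_glue[OF \<tau>T R _ A] by blast
  show \<kappa>: "\<kappa> \<in> Theta_from R"
    using Theta_fromD(2)[OF \<tau>] by (intro Theta_fromI[OF \<kappa>T]) (auto simp: \<kappa>_def elim: eventually_mono)
  define \<xi> where "\<xi> \<nu> x = (if \<nu> x = \<tau> x then \<eta> x else if \<nu> x = R x then \<zeta> x else 0)" for \<nu> x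
  have \<xi>_meas: "\<xi> \<nu> \<in> borel_measurable (pre_sigma \<nu>)" if \<nu>: "\<nu> \<in> Theta" for \<nu>
    unfolding \<xi>_def using \<eta> \<zeta> that \<tau>T R
    by (intro measurable_on_stopping_time_eq Theta_stopping_time) (auto simp: Lp_def)
  have bound: "\<bar>\<xi> \<nu> x\<bar> \<le> max \<bar>\<eta> x\<bar> \<bar>\<zeta> x\<bar>" for \<nu> x
    by (simp add: \<xi>_def le_max_iff_disj)
  have \<xi>_Lp: "\<xi> \<nu> \<in> Lp M p (pre_sigma \<nu>)" "\<xi> \<nu> \<in> Lp M p M" if \<nu>: "\<nu> \<in> Theta" for \<nu>
    using measurable_pre_sigma_M[OF Theta_stopping_times[OF \<nu>] \<xi>_meas[OF \<nu>]] \<xi>_meas[OF \<nu>]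
    by (auto intro!: Lp_dominated[OF \<eta> \<zeta>] bound)
  have adm: "admissible M F Theta \<xi>"
    unfolding admissible_def using \<xi>_meas by (auto simp: \<xi>_def)
  have int: "p_integrable M p Theta \<xi>"
    unfolding p_integrable_def using \<xi>_Lp(2) by blast
  have \<xi>\<tau>: "\<xi> \<tau> = \<eta>" by (simp add: \<xi>_def fun_eq_iff)
  have \<xi>\<kappa>: "AE x in M. \<xi> \<kappa> x = \<omega> x"
    using agree by eventually_elim (auto simp: \<xi>_def \<kappa>_def \<omega>_def)
  have "\<omega> \<in> borel_measurable (pre_sigma \<kappa>)"
    by (rule measurable_pre_sigma_AE_cong[OF Theta_stopping_times[OF \<kappa>T] \<xi>_meas[OF \<kappa>T] \<xi>\<kappa>])
  then show \<omega>: "\<omega> \<in> Lp M p (pre_sigma \<kappa>)"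
    using measurable_pre_sigma_M[OF Theta_stopping_times[OF \<kappa>T], of \<omega>]
    by (intro Lp_dominated[OF \<eta> \<zeta>]) (auto simp: \<omega>_def)
  have "AE x in M. x \<in> A \<longrightarrow> \<rho> R \<tau> (\<xi> \<tau>) x = \<rho> R \<kappa> (\<xi> \<kappa>) x"
    by (rule rho_zero_one[OF adm int R A \<tau> \<kappa>]) (simp add: \<kappa>_def)
  moreover have "AE x in M. \<rho> R \<kappa> (\<xi> \<kappa>) x = \<rho> R \<kappa> \<omega> x"
    by (rule rho_AE_cong[OF R \<kappa>T \<xi>_Lp(1)[OF \<kappa>T] \<omega> \<xi>\<kappa>])
  ultimately show "AE x in M. x \<in> A \<longrightarrow> \<rho> R \<tau> \<eta> x = \<rho> R \<kappa> \<omega> x"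
    unfolding \<xi>\<tau> by eventually_elim simp
qed

text \<open>
  Both sides are compared with the time and payoff stopped off \<open>A\<close>, which up to null sets is the same
  for the two.
\<close>

lemma rho_local:
  assumes R: "R \<in> Theta" and \<sigma>: "\<sigma> \<in> Theta_from R" and \<tau>: "\<tau> \<in> Theta_from R"
    and A: "A \<in> sets (pre_sigma R)"
    and \<eta>: "\<eta> \<in> Lp M p (pre_sigma \<sigma>)" and \<eta>': "\<eta>' \<in> Lp M p (pre_sigma \<tau>)"
    and \<zeta>: "\<zeta> \<in> Lp M p (pre_sigma R)"
    and agree: "AE x in M. \<sigma> x = R x \<longrightarrow> \<eta> x = \<zeta> x" "AE x in M. \<tau> x = R x \<longrightarrow> \<eta>' x = \<zeta> x"
    and eq: "AE x in M. x \<in> A \<longrightarrow> \<sigma> x = \<tau> x \<and> \<eta> x = \<eta>' x"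
  shows "AE x in M. x \<in> A \<longrightarrow> \<rho> R \<sigma> \<eta> x = \<rho> R \<tau> \<eta>' x"
proof -
  note 1 = rho_stop_off_event[OF R \<sigma> A \<eta> \<zeta> agree(1)]
  note 2 = rho_stop_off_event[OF R \<tau> A \<eta>' \<zeta> agree(2)]
  let ?\<kappa>1 = "\<lambda>x. if x \<in> A then \<sigma> x else R x" and ?\<kappa>2 = "\<lambda>x. if x \<in> A then \<tau> x else R x"
  let ?\<omega>1 = "\<lambda>x. if x \<in> A then \<eta> x else \<zeta> x" and ?\<omega>2 = "\<lambda>x. if x \<in> A then \<eta>' x else \<zeta> x"
  have \<kappa>_eq: "AE x in M. ?\<kappa>1 x = ?\<kappa>2 x" and \<omega>_eq: "AE x in M. ?\<omega>1 x = ?\<omega>2 x"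
    using eq by (auto elim: eventually_mono)
  have \<omega>: "?\<omega>2 \<in> Lp M p (pre_sigma ?\<kappa>1)"
    using \<kappa>_eq
    by (intro Lp_pre_sigma_mono[OF Theta_fromD(1)[OF 2(1)] Theta_fromD(1)[OF 1(1)] _ 2(2)])
       (auto elim: eventually_mono)
  have "AE x in M. \<rho> R ?\<kappa>1 ?\<omega>1 x = \<rho> R ?\<kappa>1 ?\<omega>2 x"
    by (rule rho_AE_cong[OF R Theta_fromD(1)[OF 1(1)] 1(2) \<omega> \<omega>_eq])
  moreover have "AE x in M. \<rho> R ?\<kappa>1 ?\<omega>2 x = \<rho> R ?\<kappa>2 ?\<omega>2 x"
    by (rule rho_time_AE_cong[OF R 1(1) 2(1) \<kappa>_eq 2(2)])
  ultimately show ?thesis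
    using 1(3) 2(3) by eventually_elim auto
qed

end

section \<open>Rewards of pairs of stopping times\<close>

locale double_stopping = nonlinear_evaluation M F T \<theta> p \<rho>
  for M :: "'a measure" and F T \<theta> p \<rho> +
  fixes \<psi> :: "('a \<Rightarrow> real) \<Rightarrow> ('a \<Rightarrow> real) \<Rightarrow> 'a \<Rightarrow> real"
  assumes psi_admissible: "bi_admissible M F Theta \<psi>"
    and psi_integrable: "bi_p_integrable M p Theta \<psi>"
begin

definition reward :: "('a \<Rightarrow> real) \<Rightarrow> ('a \<Rightarrow> real) \<Rightarrow> ('a \<Rightarrow> real) \<Rightarrow> 'a \<Rightarrow> real" where
  "reward R a b = \<rho> R (sup a b) (\<psi> a b)"

definition pair_value :: "('a \<Rightarrow> real) \<Rightarrow> 'a \<Rightarrow> ereal" where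
  "pair_value R = ess_sup M (Theta_from R \<times> Theta_from R) (\<lambda>(a, b). reward R a b)"

definition second_value :: "('a \<Rightarrow> real) \<Rightarrow> 'a \<Rightarrow> ereal" where
  "second_value R = ess_sup M (Theta_from R) (\<lambda>b. \<rho> R b (\<psi> R b))"

definition first_value :: "('a \<Rightarrow> real) \<Rightarrow> 'a \<Rightarrow> ereal" where
  "first_value R = ess_sup M (Theta_from R) (\<lambda>a. \<rho> R a (\<psi> a R))"

definition stop_value :: "('a \<Rightarrow> real) \<Rightarrow> 'a \<Rightarrow> ereal" where
  "stop_value R = sup (first_value R) (second_value R)"

text \<open>
  Statements about \<open>first_value\<close> are those about \<open>second_value\<close> for the family with exchanged arguments.
\<close>

lemma swapped: "double_stopping M F T \<theta> p \<rho> (\<lambda>a b. \<psi> b a)"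
proof unfold_locales
  show "bi_admissible M F Theta (\<lambda>a b. \<psi> b a)"
    unfolding bi_admissible_def
  proof (intro conjI ballI)
    fix a b assume ab: "a \<in> Theta" "b \<in> Theta"
    then show "\<psi> b a \<in> borel_measurable (pre_sigma (sup a b))"
      using psi_admissible unfolding bi_admissible_def by (subst sup_commute) blast
    fix a' b' assume "a' \<in> Theta" "b' \<in> Theta"
    with ab have "AE x in M. b x = b' x \<and> a x = a' x \<longrightarrow> \<psi> b a x = \<psi> b' a' x"
      using psi_admissible unfolding bi_admissible_def by blast
    then show "AE x in M. a x = a' x \<and> b x = b' x \<longrightarrow> \<psi> b a x = \<psi> b' a' x"
      by eventually_elim blast
  qed
  show "bi_p_integrable M p Theta (\<lambda>a b. \<psi> b a)"
    using psi_integrable unfolding bi_p_integrable_def by blast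
qed

lemma psi_Lp:
  assumes "a \<in> Theta" "b \<in> Theta"
  shows "\<psi> a b \<in> Lp M p (pre_sigma (sup a b))"
  using psi_admissible psi_integrable assms
  unfolding bi_admissible_def bi_p_integrable_def Lp_def by blast

lemma psi_AE_cong:
  assumes "a \<in> Theta" "b \<in> Theta" "a' \<in> Theta" "b' \<in> Theta"
  shows "AE x in M. a x = a' x \<and> b x = b' x \<longrightarrow> \<psi> a b x = \<psi> a' b' x"
  using psi_admissible assms unfolding bi_admissible_def by blast

lemma reward_Lp:
  assumes "R \<in> Theta" "a \<in> Theta" "b \<in> Theta"
  shows "reward R a b \<in> Lp M p (pre_sigma R)"
  unfolding reward_def using assms by (intro rho_Lp psi_Lp Theta_sup)

lemma reward_borel:
  assumes "R \<in> Theta" "a \<in> Theta" "b \<in> Theta"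
  shows "reward R a b \<in> borel_measurable M"
  by (rule Lp_borel[OF assms(1) reward_Lp[OF assms]])

text \<open>
  This is \<open>rho_local\<close> with \<open>\<zeta> = \<psi> R R\<close>: where the later of two times in \<open>Theta_from R\<close> equals
  \<open>R\<close>, both do, so there every pair pays \<open>\<psi> R R\<close>.
\<close>

lemma reward_local:
  assumes R: "R \<in> Theta" and a: "a \<in> Theta_from R" and b: "b \<in> Theta_from R"
    and a': "a' \<in> Theta_from R" and b': "b' \<in> Theta_from R" and A: "A \<in> sets (pre_sigma R)"
    and eq: "AE x in M. x \<in> A \<longrightarrow> a x = a' x \<and> b x = b' x"
  shows "AE x in M. x \<in> A \<longrightarrow> reward R a b x = reward R a' b' x"
proof -
  note T = a[THEN Theta_fromD(1)] b[THEN Theta_fromD(1)] a'[THEN Theta_fromD(1)] b'[THEN Theta_fromD(1)]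
  have R_Lp: "\<psi> R R \<in> Lp M p (pre_sigma R)" using psi_Lp[OF R R] by simp
  have at_R: "AE x in M. sup c d x = R x \<longrightarrow> \<psi> c d x = \<psi> R R x"
    if c: "c \<in> Theta_from R" and d: "d \<in> Theta_from R" for c d
    using psi_AE_cong[OF Theta_fromD(1)[OF c] Theta_fromD(1)[OF d] R R]
      Theta_fromD(2)[OF c] Theta_fromD(2)[OF d]
  proof eventually_elim
    case (elim x)
    show ?case
    proof
      assume "sup c d x = R x"
      then have "c x \<le> R x" "d x \<le> R x" by (auto simp: sup_fun_def sup_max)
      with elim show "\<psi> c d x = \<psi> R R x" by auto
    qed
  qed
  have "AE x in M. x \<in> A \<longrightarrow> sup a b x = sup a' b' x \<and> \<psi> a b x = \<psi> a' b' x"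
    using eq psi_AE_cong[OF T] by eventually_elim (auto simp: sup_fun_def)
  then show ?thesis
    unfolding reward_def
    by (intro rho_local[OF R Theta_from_sup1[OF a T(2)] Theta_from_sup1[OF a' T(4)] A
          psi_Lp[OF T(1,2)] psi_Lp[OF T(3,4)] R_Lp at_R[OF a b] at_R[OF a' b']])
qed

text \<open>
  Follow \<open>(a, b)\<close> where its reward is the larger one and \<open>(a', b')\<close> elsewhere; by locality the pasted
  pair receives the larger of the two rewards.
\<close>

lemma reward_directed:
  assumes R: "R \<in> Theta" and a: "a \<in> Theta_from R" and b: "b \<in> Theta_from R"
    and a': "a' \<in> Theta_from R" and b': "b' \<in> Theta_from R"
  shows "\<exists>c\<in>Theta_from R. \<exists>d\<in>Theta_from R.
    AE x in M. reward R a b x \<le> reward R c d x \<and> reward R a' b' x \<le> reward R c d x"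
proof -
  note T = a[THEN Theta_fromD(1)] b[THEN Theta_fromD(1)] a'[THEN Theta_fromD(1)] b'[THEN Theta_fromD(1)]
  \<comment> \<open>The event is known at \<open>R\<close>, hence at all later times, so pasting along it gives Bermudan times.\<close>
  define C where "C = {x \<in> space M. reward R a' b' x \<le> reward R a b x}"
  have [measurable]: "reward R a b \<in> borel_measurable (pre_sigma R)" "reward R a' b' \<in> borel_measurable (pre_sigma R)"
    using reward_Lp[OF R T(1,2)] reward_Lp[OF R T(3,4)] by (auto simp: Lp_def)
  have "{x \<in> space (pre_sigma R). reward R a' b' x \<le> reward R a b x} \<in> sets (pre_sigma R)" by measurable
  then have C: "C \<in> sets (pre_sigma R)" by (simp add: C_def space_pre_sigma)
  have C_in: "C \<in> sets (pre_sigma \<nu>)" if "\<nu> \<in> Theta_from R" for \<nu>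
    using C pre_sigma_mono_AE[OF Theta_stopping_times[OF R] Theta_stopping_times[OF Theta_fromD(1)[OF that]]
        Theta_fromD(2)[OF that]] by auto
  have C': "space M - C \<in> sets (pre_sigma R)"
    using sets.compl_sets[OF C] by (simp add: space_pre_sigma)
  have glue: "(\<lambda>x. if x \<in> C then \<mu> x else \<nu> x) \<in> Theta_from R"
    if \<mu>: "\<mu> \<in> Theta_from R" and \<nu>: "\<nu> \<in> Theta_from R" for \<mu> \<nu>
  proof (rule Theta_fromI)
    show "(\<lambda>x. if x \<in> C then \<mu> x else \<nu> x) \<in> Theta"
      using Theta_glue[OF Theta_fromD(1)[OF \<mu>] Theta_fromD(1)[OF \<nu>] C_in[OF \<mu>] C_in[OF \<nu>]] .
    show "AE x in M. R x \<le> (if x \<in> C then \<mu> x else \<nu> x)"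
      using Theta_fromD(2)[OF \<mu>] Theta_fromD(2)[OF \<nu>] by eventually_elim auto
  qed
  let ?c = "\<lambda>x. if x \<in> C then a x else a' x" and ?d = "\<lambda>x. if x \<in> C then b x else b' x"
  note c = glue[OF a a'] and d = glue[OF b b']
  have "AE x in M. x \<in> C \<longrightarrow> reward R ?c ?d x = reward R a b x"
    by (rule reward_local[OF R c d a b C]) simp
  moreover have "AE x in M. x \<in> space M - C \<longrightarrow> reward R ?c ?d x = reward R a' b' x"
    by (rule reward_local[OF R c d a' b' C']) simp
  ultimately have "AE x in M. reward R a b x \<le> reward R ?c ?d x \<and> reward R a' b' x \<le> reward R ?c ?d x"
    using AE_space by eventually_elim (auto simp: C_def)
  with c d show ?thesis by blast
qed

lemma pair_value_upper:
  assumes R: "R \<in> Theta" and "a \<in> Theta_from R" "b \<in> Theta_from R"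
  shows "AE x in M. ereal (reward R a b x) \<le> pair_value R x"
  using ess_sup_upper[of "Theta_from R \<times> Theta_from R" "\<lambda>(a, b). reward R a b" "(a, b)"]
    reward_borel[OF R] Theta_fromD(1) assms(2,3) by (auto simp: pair_value_def)

lemma pair_value_borel: "R \<in> Theta \<Longrightarrow> pair_value R \<in> borel_measurable M"
  unfolding pair_value_def using reward_borel Theta_fromD(1) by (intro ess_sup_measurable) auto

lemma pair_value_limit:
  assumes R: "R \<in> Theta"
  obtains a b where "\<And>n::nat. a n \<in> Theta_from R" "\<And>n. b n \<in> Theta_from R"
    "\<And>n. AE x in M. reward R (a n) (b n) x \<le> reward R (a (Suc n)) (b (Suc n)) x"
    "AE x in M. (\<lambda>n. ereal (reward R (a n) (b n) x)) \<longlonglongrightarrow> pair_value R x"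
proof -
  let ?I = "Theta_from R \<times> Theta_from R" and ?f = "\<lambda>(a, b). reward R a b"
  have meas: "?f i \<in> borel_measurable M" if "i \<in> ?I" for i
    using that reward_borel[OF R] Theta_fromD(1) by auto
  have ne: "?I \<noteq> {}" using Theta_from_self[OF R] by blast
  have dir: "\<exists>k\<in>?I. AE x in M. ?f i x \<le> ?f k x \<and> ?f j x \<le> ?f k x"
    if "i \<in> ?I" "j \<in> ?I" for i j
    using that reward_directed[OF R, of "fst i" "snd i" "fst j" "snd j"]
    by (auto simp: mem_Times_iff split_beta)
  obtain s :: "nat \<Rightarrow> ('a \<Rightarrow> real) \<times> ('a \<Rightarrow> real)" where s: "\<And>n. s n \<in> ?I" "\<And>n. AE x in M. ?f (s n) x \<le> ?f (s (Suc n)) x"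
    "AE x in M. (\<lambda>n. ereal (?f (s n) x)) \<longlonglongrightarrow> ess_sup M ?I ?f x"
    by (rule ess_sup_directed_limit[of ?I ?f, OF meas ne dir]) (assumption | rule that)+
  show thesis
  proof (rule that[of "\<lambda>n. fst (s n)" "\<lambda>n. snd (s n)"])
    show "fst (s n) \<in> Theta_from R" "snd (s n) \<in> Theta_from R" for n using s(1)[of n] by (auto simp: mem_Times_iff)
    show "AE x in M. reward R (fst (s n)) (snd (s n)) x \<le> reward R (fst (s (Suc n))) (snd (s (Suc n))) x" for n
      using s(2)[of n] by (simp add: split_beta)
    show "AE x in M. (\<lambda>n. ereal (reward R (fst (s n)) (snd (s n)) x)) \<longlonglongrightarrow> pair_value R x"
      using s(3) by (simp add: split_beta pair_value_def)
  qed
qed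

lemma pair_value_measurable:
  assumes R: "R \<in> Theta"
  shows "pair_value R \<in> borel_measurable (pre_sigma R)"
proof -
  obtain a b where ab: "\<And>n::nat. a n \<in> Theta_from R" "\<And>n. b n \<in> Theta_from R"
    "AE x in M. (\<lambda>n. ereal (reward R (a n) (b n) x)) \<longlonglongrightarrow> pair_value R x"
    by (rule pair_value_limit[OF R]) blast
  have [measurable]: "reward R (a n) (b n) \<in> borel_measurable (pre_sigma R)" for n
    using reward_Lp[OF R Theta_fromD(1)[OF ab(1)] Theta_fromD(1)[OF ab(2)]] by (auto simp: Lp_def)
  have "(\<lambda>x. limsup (\<lambda>n. ereal (reward R (a n) (b n) x))) \<in> borel_measurable (pre_sigma R)" by measurable
  moreover have "AE x in M. limsup (\<lambda>n. ereal (reward R (a n) (b n) x)) = pair_value R x"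
    using ab(3) by eventually_elim (auto intro: lim_imp_Limsup)
  ultimately show ?thesis by (rule measurable_pre_sigma_AE_cong[OF Theta_stopping_times[OF R]])
qed

text \<open>
  The terms of \<open>second_value\<close> evaluate from time \<open>b\<close>, the reward from time \<open>sup R b\<close>.  The two times agree
  only almost surely, so the evaluations have to be identified before locality can be used.
\<close>

lemma second_value_term:
  assumes R: "R \<in> Theta" and b: "b \<in> Theta_from R"
  shows "\<rho> R b (\<psi> R b) \<in> Lp M p (pre_sigma R)"
    "AE x in M. \<rho> R b (\<psi> R b) x = reward R R b x"
proof -
  note bT = Theta_fromD(1)[OF b]
  have eq: "AE x in M. b x = sup R b x"
    using Theta_fromD(2)[OF b] by eventually_elim (auto simp: sup_fun_def sup_max)
  show "AE x in M. \<rho> R b (\<psi> R b) x = reward R R b x"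
    unfolding reward_def
    by (rule rho_time_AE_cong[OF R b Theta_from_sup1[OF Theta_from_self[OF R] bT] eq psi_Lp[OF R bT]])
  have "AE x in M. sup R b x \<le> b x" using eq by eventually_elim simp
  then have "\<psi> R b \<in> Lp M p (pre_sigma b)"
    by (rule Lp_pre_sigma_mono[OF Theta_sup[OF R bT] bT _ psi_Lp[OF R bT]])
  then show "\<rho> R b (\<psi> R b) \<in> Lp M p (pre_sigma R)" by (rule rho_Lp[OF R bT])
qed

lemma second_value_upper:
  assumes R: "R \<in> Theta" and b: "b \<in> Theta_from R"
  shows "AE x in M. ereal (reward R R b x) \<le> second_value R x"
proof -
  have "AE x in M. ereal (\<rho> R b (\<psi> R b) x) \<le> second_value R x"
    unfolding second_value_def
    by (rule ess_sup_upper[OF Lp_borel[OF R second_value_term(1)[OF R]] b])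
  with second_value_term(2)[OF R b] show ?thesis by eventually_elim simp
qed

lemma second_value_least:
  assumes R: "R \<in> Theta" and h: "h \<in> borel_measurable M"
    and le: "\<And>b. b \<in> Theta_from R \<Longrightarrow> AE x in M. ereal (reward R R b x) \<le> h x"
  shows "AE x in M. second_value R x \<le> h x"
  unfolding second_value_def
proof (rule ess_sup_least[OF Lp_borel[OF R second_value_term(1)[OF R]] h])
  fix b assume b: "b \<in> Theta_from R"
  show "AE x in M. ereal (\<rho> R b (\<psi> R b) x) \<le> h x"
    using le[OF b] second_value_term(2)[OF R b] by eventually_elim simp
qed

lemma second_value_measurable:
  assumes R: "R \<in> Theta"
  shows "second_value R \<in> borel_measurable (pre_sigma R)"
proof -
  obtain J where J: "countable J" "J \<subseteq> Theta_from R"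
    "AE x in M. second_value R x = (SUP b\<in>J. ereal (\<rho> R b (\<psi> R b) x))"
    unfolding second_value_def
    by (rule ess_sup_eq_countable_SUP[OF Lp_borel[OF R second_value_term(1)[OF R]]])
  have "(\<lambda>x. SUP b\<in>J. ereal (\<rho> R b (\<psi> R b) x)) \<in> borel_measurable (pre_sigma R)"
    using J(1,2) second_value_term(1)[OF R]
    by (intro borel_measurable_SUP borel_measurable_ereal) (auto simp: Lp_def)
  then show ?thesis
    by (rule measurable_pre_sigma_AE_cong[OF Theta_stopping_times[OF R]])
      (use J(3) in \<open>eventually_elim, simp\<close>)
qed

lemma second_value_borel: "R \<in> Theta \<Longrightarrow> second_value R \<in> borel_measurable M"
  by (rule measurable_pre_sigma_M[OF Theta_stopping_times second_value_measurable])

text \<open>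
  Move a competitor \<open>b\<close> for \<open>R\<close> to \<open>sup b R'\<close>.  On \<open>{R = R'}\<close> this does not change \<open>b\<close>, so locality keeps
  the reward; then \<open>rho_bis_1\<close> exchanges \<open>R\<close> for \<open>R'\<close>.  Replacing the bound by \<open>\<infinity>\<close> off that event
  turns the claim into one to which the minimality of the essential supremum applies.
\<close>

lemma second_value_local:
  assumes R: "R \<in> Theta" and R': "R' \<in> Theta"
  shows "AE x in M. R x = R' x \<longrightarrow> second_value R x \<le> second_value R' x"
proof -
  have [measurable]: "second_value R' \<in> borel_measurable M" "R \<in> borel_measurable M" "R' \<in> borel_measurable M"
    using second_value_borel[OF R'] Theta_borel[OF R] Theta_borel[OF R'] by auto
  have "AE x in M. second_value R x \<le> (if R x = R' x then second_value R' x else \<infinity>)"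
  proof (rule second_value_least[OF R])
    show "(\<lambda>x. if R x = R' x then second_value R' x else \<infinity>) \<in> borel_measurable M" by measurable
    fix b assume b: "b \<in> Theta_from R"
    note bT = Theta_fromD(1)[OF b]
    let ?c = "sup b R'"
    have c: "?c \<in> Theta_from R" by (rule Theta_from_sup1[OF b R'])
    have c': "?c \<in> Theta_from R'" unfolding sup_commute[of b]
      by (rule Theta_from_sup1[OF Theta_from_self[OF R'] bT])
    have "AE x in M. x \<in> {x \<in> space M. R' x = R x} \<longrightarrow> reward R R b x = reward R R ?c x"
    proof (rule reward_local[OF R Theta_from_self[OF R] b Theta_from_self[OF R] c])
      show "{x \<in> space M. R' x = R x} \<in> sets (pre_sigma R)"
        by (rule stopping_time_eq_event[OF Theta_stopping_time[OF R'] Theta_stopping_time[OF R]])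
      show "AE x in M. x \<in> {x \<in> space M. R' x = R x} \<longrightarrow> R x = R x \<and> b x = ?c x"
        using Theta_fromD(2)[OF b] by eventually_elim (auto simp: sup_fun_def sup_max)
    qed
    moreover have "AE x in M. R x = R' x \<longrightarrow> reward R R ?c x = reward R' R' ?c x"
      unfolding reward_def
      by (rule rho_bis_1[OF psi_admissible psi_integrable R R' Theta_fromD(1)[OF c]])
    ultimately show "AE x in M. ereal (reward R R b x) \<le> (if R x = R' x then second_value R' x else \<infinity>)"
      using second_value_upper[OF R' c'] AE_space by eventually_elim auto
  qed
  then show ?thesis by eventually_elim auto
qed

text \<open>
  On \<open>{a \<le> b}\<close> the first component equals \<open>inf a b\<close>, so by locality the pair has the reward of a pair
  whose first decision is spent at \<open>inf a b\<close>.
\<close>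

lemma reward_le_second_value:
  assumes a: "a \<in> Theta" and b: "b \<in> Theta"
  shows "AE x in M. a x \<le> b x \<longrightarrow> ereal (reward (inf a b) a b x) \<le> second_value (inf a b) x"
proof -
  let ?m = "inf a b"
  note m = Theta_inf[OF a b]
  have am: "a \<in> Theta_from ?m" and bm: "b \<in> Theta_from ?m"
    using a b by (auto intro!: Theta_fromI)
  have "AE x in M. x \<in> {x \<in> space M. a x = ?m x} \<longrightarrow> reward ?m a b x = reward ?m ?m b x"
    by (rule reward_local[OF m am bm Theta_from_self[OF m] bm
          stopping_time_eq_event[OF Theta_stopping_time[OF a] Theta_stopping_time[OF m]]]) simp
  with second_value_upper[OF m bm] AE_space show ?thesis
    by eventually_elim (auto simp: inf_fun_def inf_min)
qed

text \<open>
  The hypothesis makes the pair optimal at time \<open>inf a b\<close>.  On \<open>{a \<le> b}\<close> this time is \<open>a\<close>, and both the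
  evaluation and the value depend on the evaluation time only locally.
\<close>

lemma second_value_attained:
  assumes a: "a \<in> Theta" and b: "b \<in> Theta"
    and ge: "AE x in M. second_value (inf a b) x \<le> ereal (reward (inf a b) a b x)"
  shows "AE x in M. a x \<le> b x \<longrightarrow> ereal (reward a a b x) = second_value a x"
proof -
  let ?m = "inf a b"
  note m = Theta_inf[OF a b]
  have "AE x in M. a x = ?m x \<longrightarrow> reward a a b x = reward ?m a b x"
    unfolding reward_def by (rule rho_admissible[OF a m Theta_sup[OF a b] psi_Lp[OF a b]])
  with ge reward_le_second_value[OF a b] second_value_local[OF a m] second_value_local[OF m a]
  show ?thesis
    by eventually_elim (auto simp: inf_fun_def inf_min min_def)
qed

lemma first_value_eq_swapped:
  "double_stopping.second_value M F T \<theta> \<rho> (\<lambda>a b. \<psi> b a) = first_value"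
  "double_stopping.reward \<rho> (\<lambda>a b. \<psi> b a) R a b = reward R b a"
proof -
  interpret swap: double_stopping M F T \<theta> p \<rho> "\<lambda>a b. \<psi> b a" by (rule swapped)
  show "swap.second_value = first_value"
    by (simp add: fun_eq_iff swap.second_value_def first_value_def)
  show "swap.reward R a b = reward R b a"
    by (simp add: swap.reward_def reward_def sup_commute)
qed

lemmas first_value_least = double_stopping.second_value_least[OF swapped, unfolded first_value_eq_swapped]
lemmas first_value_measurable = double_stopping.second_value_measurable[OF swapped, unfolded first_value_eq_swapped]

lemma reward_le_first_value:
  assumes "a \<in> Theta" "b \<in> Theta"
  shows "AE x in M. b x \<le> a x \<longrightarrow> ereal (reward (inf a b) a b x) \<le> first_value (inf a b) x"
  using double_stopping.reward_le_second_value[OF swapped assms(2,1)]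
  by (simp add: first_value_eq_swapped inf_commute[of b])

lemma first_value_attained:
  assumes "a \<in> Theta" "b \<in> Theta"
    and "AE x in M. first_value (inf a b) x \<le> ereal (reward (inf a b) a b x)"
  shows "AE x in M. b x \<le> a x \<longrightarrow> ereal (reward b a b x) = first_value b x"
  using double_stopping.second_value_attained[OF swapped assms(2,1)] assms(3)
  by (simp add: first_value_eq_swapped inf_commute[of b])

lemma reward_le_stop_value:
  assumes "a \<in> Theta" "b \<in> Theta"
  shows "AE x in M. ereal (reward (inf a b) a b x) \<le> stop_value (inf a b) x"
  using reward_le_first_value[OF assms] reward_le_second_value[OF assms]
proof eventually_elim
  case (elim x)
  show ?case
  proof (cases "a x \<le> b x")
    case True
    with elim(2) show ?thesis by (simp add: stop_value_def le_max_iff_disj)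
  next
    case False
    with elim(1) show ?thesis by (simp add: stop_value_def le_max_iff_disj)
  qed
qed

lemma stop_value_le_pair_value:
  assumes R: "R \<in> Theta"
  shows "AE x in M. stop_value R x \<le> pair_value R x"
proof -
  note self = Theta_from_self[OF R]
  have "AE x in M. first_value R x \<le> pair_value R x"
    by (rule first_value_least[OF R pair_value_borel[OF R]]) (rule pair_value_upper[OF R _ self])
  moreover have "AE x in M. second_value R x \<le> pair_value R x"
    by (rule second_value_least[OF R pair_value_borel[OF R]]) (rule pair_value_upper[OF R self])
  ultimately show ?thesis by eventually_elim (simp add: stop_value_def)
qed

end

section \<open>The supermartingale property of the value\<close>

locale integrable_double_stopping = double_stopping M F T \<theta> p \<rho> \<psi>
  for M :: "'a measure" and F T \<theta> p \<rho> \<psi> +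
  assumes pair_value_finite: "R \<in> Theta \<Longrightarrow> AE x in M. \<bar>pair_value R x\<bar> \<noteq> \<infinity>"
    and pair_value_Lp_M: "R \<in> Theta \<Longrightarrow> (\<lambda>x. real_of_ereal (pair_value R x)) \<in> Lp M p M"
begin

lemma pair_value_Lp:
  assumes R: "R \<in> Theta"
  shows "(\<lambda>x. real_of_ereal (pair_value R x)) \<in> Lp M p (pre_sigma R)"
  using pair_value_Lp_M[OF R] borel_measurable_real_of_ereal[OF pair_value_measurable[OF R]]
  by (auto simp: Lp_def)

text \<open>
  Evaluating at \<open>S\<close> an increasing sequence of rewards with limit \<open>pair_value R\<close> gives, by consistency,
  rewards at \<open>S\<close> of pairs that are admitted in \<open>pair_value S\<close>; the Fatou property passes to the limit.
\<close>

lemma pair_value_supermartingale: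
  assumes S: "S \<in> Theta" and R: "R \<in> Theta_from S"
  shows "AE x in M. ereal (\<rho> S R (\<lambda>x. real_of_ereal (pair_value R x)) x) \<le> pair_value S x"
proof -
  note RT = Theta_fromD(1)[OF R]
  obtain a b where ab: "\<And>n::nat. a n \<in> Theta_from R" "\<And>n. b n \<in> Theta_from R"
    and mono: "\<And>n. AE x in M. reward R (a n) (b n) x \<le> reward R (a (Suc n)) (b (Suc n)) x"
    and lim: "AE x in M. (\<lambda>n. ereal (reward R (a n) (b n) x)) \<longlonglongrightarrow> pair_value R x"
    by (rule pair_value_limit[OF RT]) blast
  note abT = ab[THEN Theta_fromD(1)]
  have "AE x in M. (\<lambda>n. reward R (a n) (b n) x) \<longlonglongrightarrow> real_of_ereal (pair_value R x)"
    using lim pair_value_finite[OF RT]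
  proof eventually_elim
    case (elim x)
    then have "(\<lambda>n. ereal (reward R (a n) (b n) x)) \<longlonglongrightarrow> ereal (real_of_ereal (pair_value R x))"
      by (simp add: ereal_real')
    then show ?case by simp
  qed
  then have "AE x in M. ereal (\<rho> S R (\<lambda>x. real_of_ereal (pair_value R x)) x)
      \<le> liminf (\<lambda>n. ereal (\<rho> S R (reward R (a n) (b n)) x))"
    by (intro rho_Fatou S RT reward_Lp abT pair_value_Lp mono)
  moreover have "AE x in M. \<forall>n. ereal (\<rho> S R (reward R (a n) (b n)) x) \<le> pair_value S x"
    unfolding AE_all_countable
  proof
    fix n
    have "AE x in M. \<rho> S R (reward R (a n) (b n)) x = reward S (a n) (b n) x"
      unfolding reward_def
      using Theta_fromD(2)[OF Theta_from_sup1[OF ab(1) abT(2)]]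
      by (intro rho_consistent S RT Theta_sup abT psi_Lp Theta_fromD(2)[OF R])
    with pair_value_upper[OF S Theta_from_trans[OF R ab(1)] Theta_from_trans[OF R ab(2)], of n n]
    show "AE x in M. ereal (\<rho> S R (reward R (a n) (b n)) x) \<le> pair_value S x"
      by eventually_elim simp
  qed
  ultimately show ?thesis
  proof eventually_elim
    case (elim x)
    have "liminf (\<lambda>n. ereal (\<rho> S R (reward R (a n) (b n)) x)) \<le> liminf (\<lambda>n. pair_value S x)"
      using elim(2) by (intro Liminf_mono) auto
    with elim(1) show ?case by (simp add: Liminf_const)
  qed
qed

text \<open>
  The value lies between the reward of stopping both at \<open>R\<close> and \<open>pair_value R\<close>, which are both in \<open>L\<^sup>p\<close>.
\<close>

lemma stop_value_Lp:
  assumes R: "R \<in> Theta"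
  shows "(\<lambda>x. real_of_ereal (stop_value R x)) \<in> Lp M p (pre_sigma R)"
    "AE x in M. \<bar>stop_value R x\<bar> \<noteq> \<infinity>"
proof -
  have sandwich: "AE x in M. ereal (reward R R R x) \<le> stop_value R x \<and> stop_value R x \<le> pair_value R x
      \<and> \<bar>pair_value R x\<bar> \<noteq> \<infinity>"
    using reward_le_stop_value[OF R R] stop_value_le_pair_value[OF R] pair_value_finite[OF R]
    by eventually_elim simp
  then show "AE x in M. \<bar>stop_value R x\<bar> \<noteq> \<infinity>" by eventually_elim auto
  have "stop_value R \<in> borel_measurable (pre_sigma R)"
    using first_value_measurable[OF R] second_value_measurable[OF R]
    by (simp add: stop_value_def sup_fun_def sup_max)
  then have meas: "(\<lambda>x. real_of_ereal (stop_value R x)) \<in> borel_measurable (pre_sigma R)"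
    by measurable
  show "(\<lambda>x. real_of_ereal (stop_value R x)) \<in> Lp M p (pre_sigma R)"
  proof (rule Lp_dominated[OF reward_Lp[OF R R R] pair_value_Lp[OF R] meas
        measurable_pre_sigma_M[OF Theta_stopping_times[OF R] meas]])
    show "AE x in M. \<bar>real_of_ereal (stop_value R x)\<bar> \<le> max \<bar>reward R R R x\<bar> \<bar>real_of_ereal (pair_value R x)\<bar>"
      using sandwich
    proof eventually_elim
      case (elim x)
      then obtain v w where "stop_value R x = ereal v" "pair_value R x = ereal w"
        by (cases "stop_value R x"; cases "pair_value R x") auto
      moreover from this elim have "reward R R R x \<le> v" "v \<le> w" by auto
      ultimately show ?case by (simp only: real_of_ereal.simps)
    qed
  qed
qed

lemma rho_stop_value_le_pair_value:
  assumes S: "S \<in> Theta" and R: "R \<in> Theta_from S"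
  shows "AE x in M. ereal (\<rho> S R (\<lambda>x. real_of_ereal (stop_value R x)) x) \<le> pair_value S x"
proof -
  note RT = Theta_fromD(1)[OF R]
  have "AE x in M. real_of_ereal (stop_value R x) \<le> real_of_ereal (pair_value R x)"
    using stop_value_le_pair_value[OF RT] stop_value_Lp(2)[OF RT] pair_value_finite[OF RT]
  proof eventually_elim
    case (elim x)
    then show ?case by (cases "stop_value R x"; cases "pair_value R x") auto
  qed
  from rho_mono[OF S RT stop_value_Lp(1)[OF RT] pair_value_Lp[OF RT] this]
    pair_value_supermartingale[OF S R]
  show ?thesis
  proof eventually_elim
    case (elim x)
    have "ereal (\<rho> S R (\<lambda>x. real_of_ereal (stop_value R x)) x)
        \<le> ereal (\<rho> S R (\<lambda>x. real_of_ereal (pair_value R x)) x)"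
      using elim(1) by simp
    also note elim(2)
    finally show ?case .
  qed
qed

end


section \<open>Optimal pairs\<close>

theorem proposition3:
  fixes M :: "'a measure"
    and F :: "real \<Rightarrow> 'a measure"
    and T :: real
    and \<theta> :: "nat \<Rightarrow> 'a \<Rightarrow> real"
    and p :: ennreal
    and \<rho> :: "('a \<Rightarrow> real) \<Rightarrow> ('a \<Rightarrow> real) \<Rightarrow> ('a \<Rightarrow> real) \<Rightarrow> 'a \<Rightarrow> real"
    and \<psi> :: "('a \<Rightarrow> real) \<Rightarrow> ('a \<Rightarrow> real) \<Rightarrow> 'a \<Rightarrow> real"
    and V v1 v2 \<phi> u :: "('a \<Rightarrow> real) \<Rightarrow> 'a \<Rightarrow> ereal"
    and \<Theta> :: "('a \<Rightarrow> real) set"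
    and S \<tau>1 \<tau>2 :: "'a \<Rightarrow> real"
    and A :: "'a set"
  assumes rho: "nonlinear_evaluation M F T \<theta> p \<rho>"
    and Theta: "\<Theta> = bermudan_times M F T \<theta>"
    and psi_admissible: "bi_admissible M F \<Theta> \<psi>"
    and psi_integrable: "bi_p_integrable M p \<Theta> \<psi>"
    and V: "\<And>R. R \<in> \<Theta> \<Longrightarrow> V R = ess_sup M (times_from M \<Theta> R \<times> times_from M \<Theta> R)
              (\<lambda>(\<tau>1, \<tau>2). \<rho> R (sup \<tau>1 \<tau>2) (\<psi> \<tau>1 \<tau>2))"
    and V_finite: "\<And>R. R \<in> \<Theta> \<Longrightarrow> AE x in M. \<bar>V R x\<bar> \<noteq> \<infinity>"
    and V_Lp: "\<And>R. R \<in> \<Theta> \<Longrightarrow> (\<lambda>x. real_of_ereal (V R x)) \<in> Lp M p M"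
    and v1: "\<And>R. R \<in> \<Theta> \<Longrightarrow> v1 R = ess_sup M (times_from M \<Theta> R) (\<lambda>\<tau>1. \<rho> R \<tau>1 (\<psi> \<tau>1 R))"
    and v2: "\<And>R. R \<in> \<Theta> \<Longrightarrow> v2 R = ess_sup M (times_from M \<Theta> R) (\<lambda>\<tau>2. \<rho> R \<tau>2 (\<psi> R \<tau>2))"
    and phi: "\<And>R. R \<in> \<Theta> \<Longrightarrow> \<phi> R = sup (v1 R) (v2 R)"
    and u: "\<And>R. R \<in> \<Theta> \<Longrightarrow> u R = ess_sup M (times_from M \<Theta> R)
              (\<lambda>\<tau>. \<rho> R \<tau> (\<lambda>x. real_of_ereal (\<phi> \<tau> x)))"
    and S: "S \<in> \<Theta>"
    and tau: "\<tau>1 \<in> times_from M \<Theta> S" "\<tau>2 \<in> times_from M \<Theta> S"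
    and optimal: "AE x in M. V S x = ereal (\<rho> S (sup \<tau>1 \<tau>2) (\<psi> \<tau>1 \<tau>2) x)"
    and A: "A = {x \<in> space M. \<tau>1 x \<le> \<tau>2 x}"
  shows "(AE x in M. u S x =
            ereal (\<rho> S (inf \<tau>1 \<tau>2) (\<lambda>y. real_of_ereal (\<phi> (inf \<tau>1 \<tau>2) y)) x)) \<and>
         (strictly_monotone M F \<Theta> p \<rho> \<longrightarrow>
            (AE x in M. x \<in> A \<longrightarrow> ereal (\<rho> \<tau>1 (sup \<tau>1 \<tau>2) (\<psi> \<tau>1 \<tau>2) x) = v2 \<tau>1 x) \<and>
            (AE x in M. x \<in> space M - A \<longrightarrow> ereal (\<rho> \<tau>2 (sup \<tau>1 \<tau>2) (\<psi> \<tau>1 \<tau>2) x) = v1 \<tau>2 x))"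
proof -
  interpret double_stopping M F T \<theta> p \<rho> \<psi>
    using rho psi_admissible psi_integrable unfolding Theta
    by (intro double_stopping.intro double_stopping_axioms.intro)
  have V_eq: "V R = pair_value R" if "R \<in> Theta" for R
    using V[of R] that by (simp add: Theta pair_value_def reward_def)
  have v_eq: "v1 R = first_value R" "v2 R = second_value R" if "R \<in> Theta" for R
    using v1[of R] v2[of R] that by (simp_all add: Theta first_value_def second_value_def)
  have phi_eq: "\<phi> R = stop_value R" if "R \<in> Theta" for R
    using phi[of R] v_eq[OF that] that by (simp add: Theta stop_value_def)
  interpret integrable_double_stopping M F T \<theta> p \<rho> \<psi>
  proof unfold_locales
    fix R assume R: "R \<in> Theta"
    show "AE x in M. \<bar>pair_value R x\<bar> \<noteq> \<infinity>" using V_finite[of R] R by (simp add: Theta V_eq)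
    show "(\<lambda>x. real_of_ereal (pair_value R x)) \<in> Lp M p M" using V_Lp[of R] R by (simp add: Theta V_eq)
  qed
  note S' = S[unfolded Theta] and tau' = tau[unfolded Theta]
  note tauT = tau'[THEN Theta_fromD(1)]
  define m where "m = inf \<tau>1 \<tau>2"
  define \<Phi> where "\<Phi> R x = real_of_ereal (stop_value R x)" for R x
  have mT: "m \<in> Theta" unfolding m_def by (rule Theta_inf[OF tauT])
  have mS: "m \<in> Theta_from S"
  proof (rule Theta_fromI[OF mT])
    show "AE x in M. S x \<le> m x"
      using Theta_fromD(2)[OF tau'(1)] Theta_fromD(2)[OF tau'(2)]
      by eventually_elim (simp add: m_def)
  qed
  have m_le: "AE x in M. m x \<le> sup \<tau>1 \<tau>2 x" by (simp add: m_def le_infI1)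
  have \<Phi>_Lp: "\<Phi> R \<in> Lp M p (pre_sigma R)" if "R \<in> Theta" for R
    using stop_value_Lp(1)[OF that] by (simp add: \<Phi>_def[abs_def])
  \<comment> \<open>An arbitrary choice made by \<open>ess_sup\<close> is the same for both families once they define the same predicate.\<close>
  have u_eq: "u S = ess_sup M (Theta_from S) (\<lambda>\<tau>. \<rho> S \<tau> (\<Phi> \<tau>))"
  proof -
    have "\<rho> S \<tau> (\<lambda>x. real_of_ereal (\<phi> \<tau> x)) = \<rho> S \<tau> (\<Phi> \<tau>)" if "\<tau> \<in> Theta_from S" for \<tau>
      by (simp add: phi_eq[OF Theta_fromD(1)[OF that]] \<Phi>_def[abs_def])
    then have "is_ess_sup M (Theta_from S) (\<lambda>\<tau>. \<rho> S \<tau> (\<lambda>x. real_of_ereal (\<phi> \<tau> x))) =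
        is_ess_sup M (Theta_from S) (\<lambda>\<tau>. \<rho> S \<tau> (\<Phi> \<tau>))"
      by (simp add: is_ess_sup_def fun_eq_iff cong: ball_cong)
    then show ?thesis using u[OF S] by (simp add: Theta ess_sup_def)
  qed
  have u_meas: "\<rho> S \<tau> (\<Phi> \<tau>) \<in> borel_measurable M" if "\<tau> \<in> Theta_from S" for \<tau>
    using Theta_fromD(1)[OF that] by (intro Lp_borel[OF S'] rho_Lp S' \<Phi>_Lp)
  have u_le_V: "AE x in M. u S x \<le> V S x"
    unfolding u_eq V_eq[OF S']
    by (rule ess_sup_least[OF u_meas pair_value_borel[OF S']])
      (assumption, unfold \<Phi>_def[abs_def], rule rho_stop_value_le_pair_value[OF S'])
  have u_ge: "AE x in M. ereal (\<rho> S m (\<Phi> m) x) \<le> u S x"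
    unfolding u_eq by (rule ess_sup_upper[OF u_meas mS])
  have le_\<Phi>: "AE x in M. reward m \<tau>1 \<tau>2 x \<le> \<Phi> m x"
    using reward_le_stop_value[OF tauT] stop_value_Lp(2)[OF mT] unfolding m_def[symmetric]
  proof eventually_elim
    case (elim x)
    then show ?case by (cases "stop_value m x") (auto simp: \<Phi>_def)
  qed
  have V_eq_m: "AE x in M. V S x = ereal (\<rho> S m (reward m \<tau>1 \<tau>2) x)"
    using optimal rho_consistent[OF S' mT Theta_sup[OF tauT] Theta_fromD(2)[OF mS] m_le psi_Lp[OF tauT]]
    unfolding reward_def by eventually_elim simp
  \<comment> \<open>The chain \<open>V(S) \<le> \<rho> S m (\<phi>(m)) \<le> u(S) \<le> V(S)\<close> closes up.\<close>
  have chain: "AE x in M. u S x = ereal (\<rho> S m (\<Phi> m) x) \<and> \<rho> S m (reward m \<tau>1 \<tau>2) x = \<rho> S m (\<Phi> m) x"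
    using V_eq_m rho_mono[OF S' mT reward_Lp[OF mT tauT] \<Phi>_Lp[OF mT] le_\<Phi>] u_ge u_le_V
  proof eventually_elim
    case (elim x)
    from elim(3,4,1) have "\<rho> S m (\<Phi> m) x \<le> \<rho> S m (reward m \<tau>1 \<tau>2) x"
      by (metis ereal_less_eq(3) order_trans)
    with elim(2) have eq: "\<rho> S m (reward m \<tau>1 \<tau>2) x = \<rho> S m (\<Phi> m) x" by (rule antisym)
    with elim(1,3,4) show ?case by (auto intro: antisym)
  qed
  show ?thesis
  proof (intro conjI impI)
    show "AE x in M. u S x = ereal (\<rho> S (inf \<tau>1 \<tau>2) (\<lambda>y. real_of_ereal (\<phi> (inf \<tau>1 \<tau>2) y)) x)"
      using chain unfolding m_def[symmetric] phi_eq[OF mT] \<Phi>_def[abs_def] by eventually_elim blast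
  next
    assume strict: "strictly_monotone M F \<Theta> p \<rho>"
    have rho_eq: "AE x in M. \<rho> S m (reward m \<tau>1 \<tau>2) x = \<rho> S m (\<Phi> m) x"
      using chain by eventually_elim blast
    have eq: "AE x in M. reward m \<tau>1 \<tau>2 x = \<Phi> m x"
      using strict[unfolded strictly_monotone_def Theta, rule_format, OF S' mS reward_Lp[OF mT tauT]
          \<Phi>_Lp[OF mT] le_\<Phi> rho_eq] .
    have both: "AE x in M. first_value m x \<le> ereal (reward m \<tau>1 \<tau>2 x) \<and>
        second_value m x \<le> ereal (reward m \<tau>1 \<tau>2 x)"
      using eq stop_value_Lp(2)[OF mT]
    proof eventually_elim
      case (elim x)
      then have "stop_value m x = ereal (reward m \<tau>1 \<tau>2 x)" by (simp add: \<Phi>_def ereal_real')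
      moreover have "first_value m x \<le> stop_value m x" "second_value m x \<le> stop_value m x"
        by (simp_all add: stop_value_def)
      ultimately show ?case by simp
    qed
    have first: "AE x in M. first_value m x \<le> ereal (reward m \<tau>1 \<tau>2 x)"
      and second: "AE x in M. second_value m x \<le> ereal (reward m \<tau>1 \<tau>2 x)"
      using both by (auto elim: eventually_mono)
    show "AE x in M. x \<in> A \<longrightarrow> ereal (\<rho> \<tau>1 (sup \<tau>1 \<tau>2) (\<psi> \<tau>1 \<tau>2) x) = v2 \<tau>1 x"
      using second_value_attained[OF tauT second[unfolded m_def]]
      unfolding v_eq(2)[OF tauT(1)] reward_def A by eventually_elim blast
    show "AE x in M. x \<in> space M - A \<longrightarrow> ereal (\<rho> \<tau>2 (sup \<tau>1 \<tau>2) (\<psi> \<tau>1 \<tau>2) x) = v1 \<tau>2 x"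
      using first_value_attained[OF tauT first[unfolded m_def]]
      unfolding v_eq(1)[OF tauT(2)] reward_def A by eventually_elim auto
  qed
qed

end
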